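(* Let $n\in\mathbb{N}$. Then for all $\alpha,\beta\in\mathbb{C}$ with $\operatorname{Re}(\alpha),\operatorname{Re}(\beta)\in(0,\infty)$, all $z\in\mathbb{C}\setminus[0,\infty)$, and all $x,y\in\mathbb{R}^n$ with $x\neq y$, $$\int_{\mathbb{R}^n} d^n x' \, \frac{K_{(n/2)-\alpha}\big((-z)^{1/2}|x-x'|\big)\, K_{(n/2)-\beta}\big((-z)^{1/2}|x'-y|\big)}{|x-x'|^{(n/2)-\alpha}\, |x'-y|^{(n/2)-\beta}} = \frac{\kappa_{\alpha,\beta,n}}{(-z)^{n/4}}\, \frac{K_{(n/2)-\alpha-\beta}\big((-z)^{1/2}|x-y|\big)}{|x-y|^{(n/2)-\alpha-\beta}},$$ where $$\kappa_{\alpha,\beta,n}=\frac{(2\pi)^{n/2}\,2^{-1}\,\Gamma(\alpha)\Gamma(\beta)}{\Gamma(\alpha+\beta)}.$$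
   Context: $K_\nu(\cdot)$ denotes the modified Bessel function of the second kind (Macdonald function) of order $\nu\in\mathbb{C}$, and $\Gamma$ the Gamma function. For $z\in\mathbb{C}\setminus[0,\infty)$, powers $(-z)^\gamma$ are taken with the principal branch, i.e., $(-z)^\gamma=\lambda^\gamma>0$ for $z=-\lambda$, $\lambda\in(0,\infty)$, and real $\gamma$. $d^nx'$ is Lebesgue measure on $\mathbb{R}^n$. *)

theory Defs
  imports "HOL-Analysis.Analysis"
begin

text \<open>
  Modified Bessel function of the first kind,
  \<open>I\<^sub>\<nu>(z) = (z/2)\<^sup>\<nu> \<Sum>k. (z\<^sup>2/4)\<^sup>k / (k! \<Gamma>(\<nu> + k + 1))\<close>, on the principal branch of \<open>z\<^sup>\<nu>\<close>.
  The entire function \<open>rGamma\<close> is used since \<open>\<nu> + k + 1\<close> may be a pole of \<open>\<Gamma>\<close>.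
\<close>

definition bessel_I :: "complex \<Rightarrow> complex \<Rightarrow> complex" where
  "bessel_I \<nu> z = (z / 2) powr \<nu> *
     (\<Sum>k. (z\<^sup>2 / 4) ^ k / fact k * rGamma (\<nu> + of_nat k + 1))"

text \<open>
  Modified Bessel function of the second kind (Macdonald function). For integer order the
  quotient is of the form \<open>0/0\<close> and is understood as its limit in the order.
\<close>

definition bessel_K :: "complex \<Rightarrow> complex \<Rightarrow> complex" where
  "bessel_K \<nu> z =
     (let Q = (\<lambda>\<mu>. of_real pi / 2 * (bessel_I (- \<mu>) z - bessel_I \<mu> z) / sin (\<mu> * of_real pi))
      in if \<nu> \<in> \<int> then Lim (at \<nu>) Q else Q \<nu>)"

definition kappa :: "complex \<Rightarrow> complex \<Rightarrow> nat \<Rightarrow> complex" where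
  "kappa \<alpha> \<beta> n =
     (2 * of_real pi) powr (of_nat n / 2) * inverse 2 * Gamma \<alpha> * Gamma \<beta> / Gamma (\<alpha> + \<beta>)"

end

theory Submission
  imports Defs "HOL-Complex_Analysis.Complex_Analysis"
begin

text \<open>
  Put \<open>c = (-z)\<^sup>1\<^sup>/\<^sup>2 / 2\<close>, so \<open>Re c > 0\<close>. The Macdonald function has the representation
  \<open>K\<^sub>\<nu>(2 c r) / r\<^sup>\<nu> = 1/2 \<integral>\<^sub>0\<^sup>\<infinity> u\<^sup>-\<^sup>\<nu>\<^sup>-\<^sup>1 exp (- c u - c r\<^sup>2 / u) du\<close>, which holds on the whole half plane
  \<open>Re c > 0\<close> and not only for \<open>Re c\<^sup>2 > 0\<close>. Inserting it for both factors, the integral over \<open>x'\<close>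
  is a convolution of two Gaussians; what remains is an integral over \<open>u, v > 0\<close> of
  \<open>u\<^sup>\<alpha>\<^sup>-\<^sup>1 v\<^sup>\<beta>\<^sup>-\<^sup>1\<close> times a function of \<open>u + v\<close>, which splits off a Beta integral.

  To identify the integral with the series that defines \<open>K\<^sub>\<nu>\<close>, compare both as functions of
  \<open>b = r\<^sup>2\<close>: they satisfy the same relations under \<open>d/db\<close> and \<open>\<nu> \<mapsto> - \<nu>\<close> and have the same limit at
  \<open>b = 0\<close> when \<open>-1 < Re \<nu> < 0\<close>. A linear first-order system then forces equality in this strip;
  continuity in \<open>\<nu>\<close>, differentiation in \<open>b\<close> and reflection give all other orders.
\<close>

subsection \<open>The integral representing the Macdonald function\<close>

text \<open>The obstacle is the range of z: off [0, \<infinity>) one only has Re (-z)^(1/2) > 0,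
  while -z may have any argument in (-pi, pi). The familiar kernel exp (- t - s^2 / (4 t)) converges
  at t = 0 only under a sign condition on Re s^2. Putting s = 2 c r and t = c u moves the same
  factor c into both exponents, so that Re c > 0 controls each of them, and every Gaussian in x'
  carries this one complex parameter with a real weight.

  The comparison with the series runs in the real variable b with c fixed, hence treats all c alike
  instead of proving the formula for real c and continuing it.

  The interchange of integrals rests on the fact that the modulus of the integrand is the same
  integrand with all parameters replaced by their real parts. Absolute convergence is thus the same
  computation, carried out for real parameters.\<close>

lemma mult_exp_minus_le:
  fixes a t :: real
  assumes "a > 0" "t \<ge> 0"
  shows "t * exp (- (2 * a * t)) \<le> exp (- (a * t)) / a"
proof -
  have "a * t \<le> exp (a * t)"
    using exp_ge_add_one_self[of "a * t"] by linarith
  hence "a * t * exp (- (2 * a * t)) \<le> exp (a * t) * exp (- (2 * a * t))"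
    by (intro mult_right_mono) auto
  also have "\<dots> = exp (- (a * t))"
    by (simp flip: exp_add)
  finally show ?thesis
    using assms by (simp add: field_simps)
qed

text \<open>Dominated convergence for the difference quotients. Integrability is asked for on the
  positive axis only, since the modulus of the integrand depends on p through Re p. It serves twice:
  with \<phi> = u for the parameter p of the integral below, and with \<phi> = 1 / u for q.\<close>

lemma laplace_integral_has_field_derivative:
  fixes w :: "'a \<Rightarrow> complex" and \<phi> :: "'a \<Rightarrow> real" and p :: complex
  assumes [measurable]: "w \<in> borel_measurable M" "\<phi> \<in> borel_measurable M"
    and nonneg: "\<And>x. w x \<noteq> 0 \<Longrightarrow> \<phi> x \<ge> 0"
    and int: "\<And>r. r > 0 \<Longrightarrow> integrable M (\<lambda>x. w x * exp (- of_real (r * \<phi> x)))"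
    and p: "Re p > 0"
  shows "((\<lambda>p. \<integral>x. w x * exp (- (p * of_real (\<phi> x))) \<partial>M) has_field_derivative
           (\<integral>x. - (of_real (\<phi> x) * w x * exp (- (p * of_real (\<phi> x)))) \<partial>M)) (at p)"
proof -
  \<comment> \<open>Radius 2 a = Re p / 2 keeps Re q > 2 a on the disc. Half of that decay rate
    absorbs the factor \<phi> brought down by differentiation; the rate a remains in the majorant
    \<open>W\<close>.\<close>
  define a where "a = Re p / 4"
  have a: "a > 0" using p by (simp add: a_def)
  define S where "S = ball p (2 * a)"
  define f where "f = (\<lambda>p x. w x * exp (- (p * complex_of_real (\<phi> x))))"
  define f' where "f' = (\<lambda>p x. - (of_real (\<phi> x) * w x * exp (- (p * complex_of_real (\<phi> x)))))"
  have ReS: "Re q > 2 * a" if "q \<in> S" for q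
  proof -
    have "\<bar>Re (p - q)\<bar> < 2 * a"
      using that abs_Re_le_cmod[of "p - q"] by (auto simp: S_def dist_norm)
    hence "Re p - Re q < 2 * a" by (simp add: abs_less_iff)
    thus ?thesis by (simp add: a_def)
  qed
  have deriv: "((\<lambda>p. f p x) has_field_derivative f' q x) (at q within T)" for q x T
    unfolding f_def f'_def by (auto intro!: derivative_eq_intros)
  have integ: "integrable M (f q)" if "Re q > 0" for q
  proof (rule Bochner_Integration.integrable_bound[OF int[OF that]])
    show "AE x in M. norm (f q x) \<le> norm (w x * exp (- of_real (Re q * \<phi> x)))"
      by (simp add: f_def norm_mult)
  qed (simp add: f_def)
  define W where "W = (\<lambda>x. norm (w x * exp (- of_real (a * \<phi> x))) / a)"
  have W: "integrable M W"
    using int[OF a] by (simp add: W_def)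
  have bound': "norm (f' q x) \<le> W x" if "q \<in> S" for q x
  proof (cases "w x = 0")
    case False
    note nn = nonneg[OF this]
    have "norm (f' q x) = norm (w x) * (\<phi> x * exp (- (Re q * \<phi> x)))"
      using nn by (simp add: f'_def norm_mult)
    also have "\<dots> \<le> norm (w x) * (\<phi> x * exp (- (2 * a * \<phi> x)))"
      using ReS[OF that] nn by (intro mult_left_mono) (auto intro!: mult_right_mono)
    also have "\<dots> \<le> norm (w x) * (exp (- (a * \<phi> x)) / a)"
      by (intro mult_left_mono mult_exp_minus_le a nn) auto
    finally show ?thesis by (simp add: W_def norm_mult)
  qed (use a in \<open>simp add: f'_def W_def\<close>)
  \<comment> \<open>The disc is convex, so the bound on the derivative also bounds the difference
    quotients, uniformly in q.\<close>
  have lip: "norm (f q x - f p x) \<le> W x * norm (q - p)" if "q \<in> S" for q x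
    by (rule field_differentiable_bound[of S "\<lambda>q. f q x" "\<lambda>q. f' q x"])
       (use that deriv bound' a in \<open>auto simp: S_def\<close>)
  have "((\<lambda>q. (integral\<^sup>L M (f q) - integral\<^sup>L M (f p)) / (q - p)) \<longlongrightarrow> integral\<^sup>L M (f' p)) (at p within S)"
    unfolding tendsto_at_iff_sequentially
  proof (intro allI impI)
    fix X assume X: "\<forall>i. X i \<in> S - {p}" "X \<longlonglongrightarrow> p"
    have "(\<lambda>i. \<integral>x. (f (X i) x - f p x) / (X i - p) \<partial>M) \<longlonglongrightarrow> integral\<^sup>L M (f' p)"
    proof (rule integral_dominated_convergence[where w = W])
      show "AE x in M. norm ((f (X i) x - f p x) / (X i - p)) \<le> W x" for i
        using lip[of "X i"] X by (auto simp: norm_divide divide_simps)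
      show "AE x in M. (\<lambda>i. (f (X i) x - f p x) / (X i - p)) \<longlonglongrightarrow> f' p x"
      proof (intro AE_I2)
        fix x
        have "((\<lambda>q. (f q x - f p x) / (q - p)) \<longlongrightarrow> f' p x) (at p within S)"
          using deriv by (simp add: has_field_derivative_iff)
        thus "(\<lambda>i. (f (X i) x - f p x) / (X i - p)) \<longlonglongrightarrow> f' p x"
          using X unfolding tendsto_at_iff_sequentially by (auto simp: o_def)
      qed
      show "f' p \<in> borel_measurable M" "(\<lambda>x. (f (X i) x - f p x) / (X i - p)) \<in> borel_measurable M" for i
        by (simp_all add: f'_def f_def)
    qed (rule W)
    also have "(\<lambda>i. \<integral>x. (f (X i) x - f p x) / (X i - p) \<partial>M) =
               (\<lambda>i. (integral\<^sup>L M (f (X i)) - integral\<^sup>L M (f p)) / (X i - p))"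
    proof
      fix i
      have "Re (X i) > 0" using X ReS[of "X i"] a by force
      thus "(\<integral>x. (f (X i) x - f p x) / (X i - p) \<partial>M) =
            (integral\<^sup>L M (f (X i)) - integral\<^sup>L M (f p)) / (X i - p)"
        using integ p by simp
    qed
    finally show "((\<lambda>q. (integral\<^sup>L M (f q) - integral\<^sup>L M (f p)) / (q - p)) \<circ> X) \<longlonglongrightarrow> integral\<^sup>L M (f' p)"
      by (simp add: o_def)
  qed
  moreover have "at p within S = at p"
    using a by (intro at_within_open) (auto simp: S_def)
  ultimately show ?thesis
    unfolding has_field_derivative_iff f_def f'_def by simp
qed

text \<open>The parameters p and q are kept independent, although p = c and q = c b in the
  application: differentiation in q alone shifts the order, and q = 0 leaves a Gamma integral.
  Extension by 0 makes it a function on the whole line, ready for product measures.\<close>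

definition macdonald_integrand :: "complex \<Rightarrow> complex \<Rightarrow> complex \<Rightarrow> real \<Rightarrow> complex" where
  "macdonald_integrand \<nu> p q u =
     (if u > 0 then of_real u powr (- \<nu> - 1) * exp (- (p * of_real u)) * exp (- (q * of_real (1 / u))) else 0)"

definition macdonald_integral :: "complex \<Rightarrow> complex \<Rightarrow> complex \<Rightarrow> complex" where
  "macdonald_integral \<nu> p q = (\<integral>u. macdonald_integrand \<nu> p q u \<partial>lborel)"

lemma macdonald_integrand_measurable [measurable]:
  "macdonald_integrand \<nu> p q \<in> borel_measurable borel"
  unfolding macdonald_integrand_def[abs_def] powr_def by measurable

lemma norm_macdonald_integrand:
  "norm (macdonald_integrand \<nu> p q u) =
     (if u > 0 then u powr (- Re \<nu> - 1) * exp (- (Re p * u)) * exp (- (Re q / u)) else 0)"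
  by (auto simp: macdonald_integrand_def norm_mult norm_powr_real_powr)

text \<open>The factor with q has modulus at most 1, and for Re \<nu> < 0 the remaining power is
  integrable at 0, so the Gamma integrand is a majorant.\<close>

lemma integrable_macdonald_integrand_Re_less_0:
  assumes "Re \<nu> < 0" "Re p > 0" "Re q \<ge> 0"
  shows "integrable lborel (macdonald_integrand \<nu> p q)"
proof -
  have "(\<lambda>t. complex_of_real t powr (- \<nu> - 1) / of_real (exp (Re p * t))) absolutely_integrable_on {0<..}"
    using absolutely_integrable_Gamma_integral[of "- \<nu>" "Re p"] assms by simp
  also have "?this \<longleftrightarrow> integrable lebesgue (\<lambda>t. macdonald_integrand \<nu> (of_real (Re p)) 0 t)"
    unfolding set_integrable_def
    by (intro Bochner_Integration.integrable_cong)
       (auto simp: macdonald_integrand_def exp_minus divide_inverse simp flip: exp_of_real)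
  finally have "integrable lborel (macdonald_integrand \<nu> (of_real (Re p)) 0)"
    by (subst (asm) integrable_completion) auto
  thus ?thesis
  proof (rule Bochner_Integration.integrable_bound)
    show "AE x in lborel. norm (macdonald_integrand \<nu> p q x) \<le> norm (macdonald_integrand \<nu> (of_real (Re p)) 0 x)"
      using assms by (auto simp: norm_macdonald_integrand mult_le_cancel_left1)
  qed auto
qed

lemma exp_minus_le_powr:
  fixes s x :: real
  assumes "s > 0" "x > 0"
  shows "exp (- x) \<le> (s / x) powr s"
proof -
  have "x / s \<le> exp (x / s)"
    using exp_ge_add_one_self[of "x / s"] by linarith
  hence "(x / s) powr s \<le> exp (x / s) powr s"
    using assms by (intro powr_mono2) auto
  also have "\<dots> = exp x"
    using assms by (simp add: powr_def)
  finally show ?thesis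
    using assms by (simp add: exp_minus powr_divide field_simps)
qed

text \<open>For Re q > 0 the factor exp (- q / u) is worth any power u^s near 0, which lowers the
  order by s; the choice of s makes the real part of the new order negative.\<close>

lemma integrable_macdonald_integrand:
  assumes "Re p > 0" "Re q > 0"
  shows "integrable lborel (macdonald_integrand \<nu> p q)"
proof -
  define s where "s = \<bar>Re \<nu>\<bar> + 1"
  define \<mu> where "\<mu> = \<nu> - of_real s"
  have s: "s > 0" and \<mu>: "Re \<mu> < 0" by (auto simp: s_def \<mu>_def)
  have int: "integrable lborel (\<lambda>u. of_real ((s / Re q) powr s) * macdonald_integrand \<mu> p 0 u)"
    using assms \<mu> by (intro integrable_mult_right integrable_macdonald_integrand_Re_less_0) auto
  show ?thesis
  proof (rule Bochner_Integration.integrable_bound[OF int])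
    have "norm (macdonald_integrand \<nu> p q u) \<le> norm (of_real ((s / Re q) powr s) * macdonald_integrand \<mu> p 0 u)"
      if u: "u > 0" for u
    proof -
      have "exp (- (Re q / u)) \<le> (s / (Re q / u)) powr s"
        using exp_minus_le_powr[of s "Re q / u"] s u assms by simp
      also have "\<dots> = (s / Re q) powr s * u powr s"
        using s u assms by (simp flip: powr_mult)
      finally have "norm (macdonald_integrand \<nu> p q u) \<le>
          u powr (- Re \<nu> - 1) * exp (- (Re p * u)) * ((s / Re q) powr s * u powr s)"
        using u by (auto simp: norm_macdonald_integrand intro!: mult_left_mono)
      also have "\<dots> = norm (of_real ((s / Re q) powr s) * macdonald_integrand \<mu> p 0 u)"
        using u by (simp add: norm_macdonald_integrand norm_mult \<mu>_def powr_diff powr_add powr_minus field_simps)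
      finally show ?thesis .
    qed
    thus "AE u in lborel. norm (macdonald_integrand \<nu> p q u) \<le>
            norm (of_real ((s / Re q) powr s) * macdonald_integrand \<mu> p 0 u)"
      by (intro AE_I2) (simp add: norm_macdonald_integrand)
  qed auto
qed

text \<open>The factor 1 / u brought down by d/dq raises the order by one.\<close>

lemma macdonald_integral_has_field_derivative:
  assumes "Re p > 0" "Re q > 0"
  shows "((\<lambda>q. macdonald_integral \<nu> p q) has_field_derivative - macdonald_integral (\<nu> + 1) p q) (at q)"
proof -
  have eq: "macdonald_integrand \<nu> p q u = macdonald_integrand \<nu> p 0 u * exp (- (q * of_real (1 / u)))" for q u
    by (simp add: macdonald_integrand_def)
  have "((\<lambda>q. \<integral>u. macdonald_integrand \<nu> p 0 u * exp (- (q * of_real (1 / u))) \<partial>lborel) has_field_derivative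
          (\<integral>u. - (of_real (1 / u) * macdonald_integrand \<nu> p 0 u * exp (- (q * of_real (1 / u)))) \<partial>lborel)) (at q)"
  proof (rule laplace_integral_has_field_derivative)
    show "integrable lborel (\<lambda>u. macdonald_integrand \<nu> p 0 u * exp (- of_real (r * (1 / u))))" if "r > 0" for r
      using integrable_macdonald_integrand[of p "of_real r" \<nu>] assms that by (simp add: eq[of "of_real r", abs_def])
  qed (use assms in \<open>auto simp: macdonald_integrand_def split: if_splits\<close>)
  also have "(\<lambda>u. of_real (1 / u) * macdonald_integrand \<nu> p 0 u * exp (- (q * of_real (1 / u)))) =
             macdonald_integrand (\<nu> + 1) p q"
    by (auto simp: macdonald_integrand_def fun_eq_iff powr_diff powr_minus powr_add field_simps power2_eq_square)
  finally show ?thesis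
    unfolding eq[symmetric] macdonald_integral_def by simp
qed

text \<open>For real p the scaling u to p u reduces to the Gamma integral. For complex p this would
  rotate the ray of integration; analytic continuation from the positive axis takes the place of
  that contour argument.\<close>

lemma macdonald_integral_0_right:
  assumes "Re \<nu> < 0" "Re p > 0"
  shows "macdonald_integral \<nu> p 0 = Gamma (- \<nu>) * p powr \<nu>"
proof -
  define F where "F = (\<lambda>p. macdonald_integral \<nu> p 0 * p powr (-\<nu>) - Gamma (-\<nu>))"
  have real: "F (of_real r) = 0" if "r > 0" for r
  proof -
    have "((\<lambda>t. of_real t powr (- \<nu> - 1) / of_real (exp t)) has_integral Gamma (- \<nu>)) {0<..}"
      using Gamma_integral_complex'[of "- \<nu>"] assms by simp
    hence "((\<lambda>t. if t \<in> {0<..} then of_real t powr (- \<nu> - 1) / of_real (exp t) else 0) has_integral Gamma (- \<nu>)) UNIV"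
      by (subst has_integral_restrict_UNIV)
    also have "(\<lambda>t. if t \<in> {0<..} then of_real t powr (- \<nu> - 1) / of_real (exp t) else 0) = macdonald_integrand \<nu> 1 0"
      by (auto simp: fun_eq_iff macdonald_integrand_def exp_minus field_simps exp_of_real)
    finally have "(macdonald_integrand \<nu> 1 0 has_integral Gamma (- \<nu>)) UNIV" .
    moreover have "(macdonald_integrand \<nu> 1 0 has_integral macdonald_integral \<nu> 1 0) UNIV"
      unfolding macdonald_integral_def using assms
      by (intro has_integral_integral_lborel integrable_macdonald_integrand_Re_less_0) auto
    ultimately have *: "macdonald_integral \<nu> 1 0 = Gamma (- \<nu>)"
      by (rule has_integral_unique[symmetric])
    have "macdonald_integral \<nu> 1 0 = r *\<^sub>R (\<integral>u. macdonald_integrand \<nu> 1 0 (0 + r * u) \<partial>lborel)"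
      unfolding macdonald_integral_def using that by (subst lborel_integral_real_affine[of r _ 0]) auto
    also have "\<dots> = (\<integral>u. of_real r * macdonald_integrand \<nu> 1 0 (0 + r * u) \<partial>lborel)"
      by (simp add: scaleR_conv_of_real)
    also have "(\<lambda>u. of_real r * macdonald_integrand \<nu> 1 0 (0 + r * u)) =
               (\<lambda>u. of_real r powr (- \<nu>) * macdonald_integrand \<nu> (of_real r) 0 u)"
      using that by (auto simp: fun_eq_iff macdonald_integrand_def zero_less_mult_iff powr_times_real
                       powr_diff field_simps)
    also have "(\<integral>u. of_real r powr (- \<nu>) * macdonald_integrand \<nu> (of_real r) 0 u \<partial>lborel) =
               of_real r powr (- \<nu>) * macdonald_integral \<nu> (of_real r) 0"
      by (simp add: macdonald_integral_def)
    finally show ?thesis using * by (simp add: F_def)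
  qed
  have deriv: "(\<lambda>p. macdonald_integral \<nu> p 0) field_differentiable (at p)" if "Re p > 0" for p
  proof -
    define w where "w = (\<lambda>u. if u > 0 then complex_of_real u powr (- \<nu> - 1) else 0)"
    have [measurable]: "w \<in> borel_measurable borel"
      unfolding w_def powr_def by measurable
    have eq: "macdonald_integrand \<nu> p 0 u = w u * exp (- (p * of_real u))" for p u
      by (simp add: macdonald_integrand_def w_def)
    have "((\<lambda>p. \<integral>u. w u * exp (- (p * of_real u)) \<partial>lborel) has_field_derivative
             (\<integral>u. - (of_real u * w u * exp (- (p * of_real u))) \<partial>lborel)) (at p)"
    proof (rule laplace_integral_has_field_derivative)
      show "integrable lborel (\<lambda>u. w u * exp (- of_real (r * u)))" if "r > 0" for r
        using integrable_macdonald_integrand_Re_less_0[of \<nu> "of_real r" 0] assms that by (simp add: eq[abs_def])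
    qed (use that in \<open>auto simp: w_def split: if_splits\<close>)
    thus ?thesis
      by (auto simp: field_differentiable_def macdonald_integral_def eq)
  qed
  have "F p = 0"
  \<comment> \<open>\<open>F\<close> is holomorphic on the half plane and vanishes on the positive
    reals, which accumulate at 1.\<close>
  proof (rule analytic_continuation[of F "{p. Re p > 0}" "complex_of_real ` {0<..}" 1])
    show "F holomorphic_on {p. Re p > 0}"
      unfolding F_def
    proof (intro holomorphic_intros)
      show "(\<lambda>p. macdonald_integral \<nu> p 0) holomorphic_on {p. Re p > 0}"
        using deriv by (auto simp: holomorphic_on_def intro: field_differentiable_at_within)
    qed (auto simp: complex_nonpos_Reals_iff)
    show "open {p. Re p > 0}" by (rule open_halfspace_Re_gt)
    show "connected {p. Re p > 0}" by (intro convex_connected convex_halfspace_Re_gt)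
    show "1 islimpt complex_of_real ` {0<..}"
    proof -
      have "(1::real) islimpt {0<..}"
        by (intro interior_limit_point) (auto simp: interior_open)
      hence "complex_of_real 1 islimpt complex_of_real ` {0<..}"
        by (subst islimpt_isCont_image) (auto simp: eventually_at_filter)
      thus ?thesis by simp
    qed
  qed (use real assms in auto)
  moreover have "p \<noteq> 0" using assms by auto
  ultimately show ?thesis by (simp add: F_def powr_minus field_simps)
qed

lemma isCont_macdonald_integral_order:
  assumes "Re p > 0" "Re q > 0"
  shows "isCont (\<lambda>\<nu>. macdonald_integral \<nu> p q) \<nu>"
proof -
  \<comment> \<open>For an order within distance 1 of \<nu>, the power of u is dominated by that of
    order \<nu> - 1 if u \<ge> 1 and by that of order \<nu> + 1 if u < 1; the sum of both serves for
    all u.\<close>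
  define W where "W = (\<lambda>u. norm (macdonald_integrand (\<nu> + 1) p q u) + norm (macdonald_integrand (\<nu> - 1) p q u))"
  have W: "integrable lborel W"
    unfolding W_def by (intro Bochner_Integration.integrable_add integrable_norm integrable_macdonald_integrand assms)
  have "((\<lambda>\<nu>. macdonald_integral \<nu> p q) \<longlongrightarrow> macdonald_integral \<nu> p q) (at \<nu> within ball \<nu> 1)"
    unfolding tendsto_at_iff_sequentially
  proof (intro allI impI)
    fix X assume X: "\<forall>i. X i \<in> ball \<nu> 1 - {\<nu>}" "X \<longlonglongrightarrow> \<nu>"
    have "(\<lambda>i. \<integral>u. macdonald_integrand (X i) p q u \<partial>lborel) \<longlonglongrightarrow> (\<integral>u. macdonald_integrand \<nu> p q u \<partial>lborel)"
    proof (rule integral_dominated_convergence[where w = W])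
      show "AE u in lborel. (\<lambda>i. macdonald_integrand (X i) p q u) \<longlonglongrightarrow> macdonald_integrand \<nu> p q u"
      proof (intro AE_I2)
        fix u :: real
        show "(\<lambda>i. macdonald_integrand (X i) p q u) \<longlonglongrightarrow> macdonald_integrand \<nu> p q u"
        proof (cases "u > 0")
          case True
          hence "complex_of_real u \<noteq> 0" by simp
          have "(\<lambda>i. exp ((- X i - 1) * Ln (of_real u))) \<longlonglongrightarrow> exp ((- \<nu> - 1) * Ln (of_real u))"
            by (intro tendsto_exp tendsto_mult tendsto_diff tendsto_minus tendsto_const X(2))
          thus ?thesis
            unfolding macdonald_integrand_def powr_def if_P[OF True] if_not_P[OF \<open>complex_of_real u \<noteq> 0\<close>]
            by (intro tendsto_mult tendsto_const)
        qed (simp add: macdonald_integrand_def)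
      qed
      have "norm (macdonald_integrand (X i) p q u) \<le> W u" for i u
      proof (cases "u > 0")
        case True
        have "norm (X i - \<nu>) < 1" using X by (auto simp: dist_norm norm_minus_commute)
        hence "\<bar>Re (X i) - Re \<nu>\<bar> < 1" using abs_Re_le_cmod[of "X i - \<nu>"] by simp
        hence "u powr (- Re (X i) - 1) \<le> u powr (- Re \<nu> - 2) + u powr (- Re \<nu>)"
        proof (cases "u \<ge> 1")
          case True
          have "u powr (- Re (X i) - 1) \<le> u powr (- Re \<nu>)"
            using True \<open>\<bar>Re (X i) - Re \<nu>\<bar> < 1\<close> by (intro powr_mono) linarith+
          thus ?thesis using powr_ge_zero[of u "- Re \<nu> - 2"] by linarith
        next
          case False
          have "u powr (- Re (X i) - 1) \<le> u powr (- Re \<nu> - 2)"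
            using False \<open>u > 0\<close> \<open>\<bar>Re (X i) - Re \<nu>\<bar> < 1\<close> by (intro powr_mono') linarith+
          thus ?thesis using powr_ge_zero[of u "- Re \<nu>"] by linarith
        qed
        hence "u powr (- Re (X i) - 1) * (exp (- (Re p * u)) * exp (- (Re q / u))) \<le>
               (u powr (- Re \<nu> - 2) + u powr (- Re \<nu>)) * (exp (- (Re p * u)) * exp (- (Re q / u)))"
          by (rule mult_right_mono) auto
        also have "\<dots> = W u"
          using True by (simp add: W_def norm_macdonald_integrand algebra_simps)
        finally show ?thesis using True by (simp add: norm_macdonald_integrand mult.assoc)
      qed (simp add: W_def macdonald_integrand_def)
      thus "AE u in lborel. norm (macdonald_integrand (X i) p q u) \<le> W u" for i by simp
    qed (use W in auto)
    thus "((\<lambda>\<nu>. macdonald_integral \<nu> p q) \<circ> X) \<longlonglongrightarrow> macdonald_integral \<nu> p q"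
      by (simp add: macdonald_integral_def o_def)
  qed
  moreover have "at \<nu> within ball \<nu> 1 = at \<nu>"
    by (intro at_within_open) auto
  ultimately show ?thesis by (simp add: isCont_def)
qed

lemma tendsto_macdonald_integral_at_right_0:
  assumes "Re \<nu> < 0" "Re c > 0"
  shows "((\<lambda>b. macdonald_integral \<nu> c (c * of_real b)) \<longlongrightarrow> Gamma (- \<nu>) * c powr \<nu>) (at_right 0)"
  unfolding tendsto_at_iff_sequentially macdonald_integral_0_right[OF assms, symmetric]
proof (intro allI impI)
  fix X assume X: "\<forall>i. X i \<in> {0<..} - {0}" "X \<longlonglongrightarrow> (0::real)"
  have "(\<lambda>i. \<integral>u. macdonald_integrand \<nu> c (c * of_real (X i)) u \<partial>lborel) \<longlonglongrightarrow> (\<integral>u. macdonald_integrand \<nu> c 0 u \<partial>lborel)"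
  proof (rule integral_dominated_convergence[where w = "\<lambda>u. norm (macdonald_integrand \<nu> c 0 u)"])
    have "(\<lambda>i. macdonald_integrand \<nu> c (c * of_real (X i)) u) \<longlonglongrightarrow> macdonald_integrand \<nu> c (c * of_real 0) u" for u
    proof (cases "u > 0")
      case True
      have "(\<lambda>i. exp (- (c * complex_of_real (X i) * of_real (1 / u)))) \<longlonglongrightarrow> exp (- (c * of_real 0 * of_real (1 / u)))"
        by (intro tendsto_intros X)
      thus ?thesis unfolding macdonald_integrand_def if_P[OF True] by (rule tendsto_mult_left)
    qed (simp add: macdonald_integrand_def)
    thus "AE u in lborel. (\<lambda>i. macdonald_integrand \<nu> c (c * of_real (X i)) u) \<longlonglongrightarrow> macdonald_integrand \<nu> c 0 u"
      by simp
    show "AE u in lborel. norm (macdonald_integrand \<nu> c (c * of_real (X i)) u) \<le> norm (macdonald_integrand \<nu> c 0 u)" for i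
      using X assms by (intro AE_I2) (auto simp: norm_macdonald_integrand less_imp_le)
    show "integrable lborel (\<lambda>u. norm (macdonald_integrand \<nu> c 0 u))"
      using assms by (intro integrable_norm integrable_macdonald_integrand_Re_less_0) auto
  qed auto
  thus "((\<lambda>b. macdonald_integral \<nu> c (c * of_real b)) \<circ> X) \<longlonglongrightarrow> macdonald_integral \<nu> c 0"
    by (simp add: macdonald_integral_def o_def)
qed

text \<open>The substitution u to b / u exchanges the exponents c u and c b / u. It stays on the
  positive ray because the ratio b of the two parameters is real.\<close>

lemma macdonald_integral_minus_order:
  assumes "Re c > 0" "b > 0"
  shows "macdonald_integral \<nu> c (c * of_real b) = of_real b powr (- \<nu>) * macdonald_integral (- \<nu>) c (c * of_real b)"
proof -
  let ?f = "macdonald_integrand \<nu> c (c * of_real b)"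
  let ?g = "macdonald_integrand (- \<nu>) c (c * of_real b)"
  have int: "integrable lborel (macdonald_integrand \<mu> c (c * of_real b))" for \<mu>
    using assms by (intro integrable_macdonald_integrand) auto
  have *: "set_integrable lebesgue {0<..} (macdonald_integrand \<mu> c (c * of_real b))"
          "integral {0<..} (macdonald_integrand \<mu> c (c * of_real b)) = macdonald_integral \<mu> c (c * of_real b)" for \<mu>
  proof -
    have eq: "(\<lambda>u. indicator {0<..} u *\<^sub>R macdonald_integrand \<mu> c (c * of_real b) u) = macdonald_integrand \<mu> c (c * of_real b)"
      by (auto simp: indicator_def macdonald_integrand_def fun_eq_iff)
    show si: "set_integrable lebesgue {0<..} (macdonald_integrand \<mu> c (c * of_real b))"
      unfolding set_integrable_def eq by (subst integrable_completion) (auto simp: int)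
    have "integral {0<..} (macdonald_integrand \<mu> c (c * of_real b)) =
          set_lebesgue_integral lebesgue {0<..} (macdonald_integrand \<mu> c (c * of_real b))"
      using set_lebesgue_integral_eq_integral(2)[OF si] by simp
    also have "\<dots> = macdonald_integral \<mu> c (c * of_real b)"
      unfolding set_lebesgue_integral_def eq macdonald_integral_def by (rule integral_completion) auto
    finally show "integral {0<..} (macdonald_integrand \<mu> c (c * of_real b)) = macdonald_integral \<mu> c (c * of_real b)" .
  qed
  have img: "(\<lambda>x. b / x) ` {0<..} = {0<..}"
  proof (intro equalityI subsetI)
    fix x :: real assume "x \<in> {0<..}"
    thus "x \<in> (\<lambda>x. b / x) ` {0<..}" using assms by (intro image_eqI[of _ _ "b / x"]) auto
  qed (use assms in auto)
  have "(\<lambda>x. \<bar>- b / x ^ 2\<bar> *\<^sub>R ?f (b / x)) absolutely_integrable_on {0<..} \<and>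
         integral {0<..} (\<lambda>x. \<bar>- b / x ^ 2\<bar> *\<^sub>R ?f (b / x)) = integral {0<..} ?f"
    by (subst has_absolute_integral_change_of_variables_real)
       (use assms *(1) in \<open>auto simp: img inj_on_def power2_eq_square field_simps intro!: derivative_eq_intros\<close>)
  hence "macdonald_integral \<nu> c (c * of_real b) = integral {0<..} (\<lambda>x. \<bar>- b / x ^ 2\<bar> *\<^sub>R ?f (b / x))"
    by (simp add: *)
  also have "\<dots> = integral {0<..} (\<lambda>x. of_real b powr (- \<nu>) * ?g x)"
  proof (intro Henstock_Kurzweil_Integration.integral_cong)
    fix x :: real assume "x \<in> {0<..}"
    hence x: "x > 0" by simp
    have "(of_real (b / x) :: complex) powr (- \<nu> - 1) = of_real b powr (- \<nu> - 1) * of_real x powr (\<nu> + 1)"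
      using assms x by (simp add: powr_def Ln_of_real ln_div algebra_simps del: of_real_divide flip: exp_add)
    thus "\<bar>- b / x ^ 2\<bar> *\<^sub>R ?f (b / x) = of_real b powr (- \<nu>) * ?g x"
      using assms x by (simp add: macdonald_integrand_def scaleR_conv_of_real powr_diff powr_add power2_eq_square field_simps)
  qed
  also have "\<dots> = of_real b powr (- \<nu>) * integral {0<..} ?g" by simp
  finally show ?thesis by (simp add: *)
qed

section \<open>The entire factor of the Bessel series, a regularized hypergeometric function 0F1 (;
  \<nu> + 1; a)\<close>

definition bessel_phi :: "complex \<Rightarrow> complex \<Rightarrow> complex" where
  "bessel_phi \<nu> a = (\<Sum>k. rGamma (\<nu> + of_nat k + 1) / fact k * a ^ k)"

text \<open>Ratio test: once k \<ge> |\<nu>| + 2 |a|, the moduli of the \<open>rGamma\<close>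
  factors no longer increase and |a| / (k + 1) \<le> 1 / 2.\<close>

lemma summable_bessel_phi: "summable (\<lambda>k. rGamma (\<nu> + of_nat k + 1) / fact k * a ^ k :: complex)"
proof -
  define N where "N = nat \<lceil>norm \<nu> + 2 * norm a\<rceil>"
  show ?thesis
  proof (rule summable_ratio_test[of "1/2" N])
    fix k assume k: "k \<ge> N"
    have N: "norm \<nu> + 2 * norm a \<le> real k"
      using k unfolding N_def by linarith
    have *: "1 \<le> norm (\<nu> + of_nat k + 1)"
    proof -
      have "norm (of_nat k + 1 :: complex) = real k + 1"
        by (metis norm_of_nat of_nat_Suc add.commute)
      moreover have "norm (of_nat k + 1 :: complex) - norm \<nu> \<le> norm (of_nat k + 1 + \<nu>)"
        by (metis norm_diff_ineq)
      moreover have "of_nat k + 1 + \<nu> = \<nu> + of_nat k + 1" by simp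
      ultimately have "real k + 1 - norm \<nu> \<le> norm (\<nu> + of_nat k + 1)" by simp
      thus ?thesis using N norm_ge_zero[of a] by linarith
    qed
    have "rGamma (\<nu> + of_nat k + 1) = (\<nu> + of_nat k + 1) * rGamma (\<nu> + of_nat (Suc k) + 1)"
      using rGamma_plus1[of "\<nu> + of_nat k + 1"] by (simp add: algebra_simps)
    hence "norm (rGamma (\<nu> + of_nat k + 1)) = norm (\<nu> + of_nat k + 1) * norm (rGamma (\<nu> + of_nat (Suc k) + 1))"
      by (simp add: norm_mult)
    also have "\<dots> \<ge> 1 * norm (rGamma (\<nu> + of_nat (Suc k) + 1))"
      using * by (rule mult_right_mono) auto
    finally have 1: "norm (rGamma (\<nu> + of_nat (Suc k) + 1)) \<le> norm (rGamma (\<nu> + of_nat k + 1))" by simp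
    have 2: "norm a / real (Suc k) \<le> 1 / 2"
      using N norm_ge_zero[of \<nu>] by (simp add: field_simps del: norm_ge_zero)
    have "norm (rGamma (\<nu> + of_nat (Suc k) + 1) / fact (Suc k) * a ^ Suc k) =
          (norm a / real (Suc k)) * (norm (rGamma (\<nu> + of_nat (Suc k) + 1)) * (norm (a ^ k) / fact k))"
      by (simp add: norm_mult norm_divide field_simps del: of_nat_Suc)
    also have "\<dots> \<le> 1 / 2 * (norm (rGamma (\<nu> + of_nat k + 1)) * (norm (a ^ k) / fact k))"
      by (intro mult_mono 1 2) auto
    finally show "norm (rGamma (\<nu> + of_nat (Suc k) + 1) / fact (Suc k) * a ^ Suc k) \<le>
          1 / 2 * norm (rGamma (\<nu> + of_nat k + 1) / fact k * a ^ k)"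
      by (simp add: norm_mult norm_divide)
  qed simp
qed

lemma bessel_phi_0: "bessel_phi \<nu> 0 = rGamma (\<nu> + 1)"
  using powser_zero[of "\<lambda>k. rGamma (\<nu> + of_nat k + 1) / fact k"] by (simp add: bessel_phi_def)

lemma bessel_phi_has_field_derivative:
  "(bessel_phi \<nu> has_field_derivative bessel_phi (\<nu> + 1) a) (at a)"
proof -
  have "((\<lambda>a. \<Sum>k. rGamma (\<nu> + of_nat k + 1) / fact k * a ^ k) has_field_derivative
          (\<Sum>k. diffs (\<lambda>k. rGamma (\<nu> + of_nat k + 1) / fact k) k * a ^ k)) (at a)"
    by (intro termdiffs_strong_converges_everywhere summable_bessel_phi)
  also have "diffs (\<lambda>k. rGamma (\<nu> + of_nat k + 1) / fact k) = (\<lambda>k. rGamma (\<nu> + 1 + of_nat k + 1) / fact k)"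
    by (simp add: diffs_def fun_eq_iff field_simps del: of_nat_Suc) (simp add: add_ac)
  finally show ?thesis by (simp add: bessel_phi_def[abs_def])
qed

lemmas bessel_phi_has_field_derivative' [derivative_intros] =
  DERIV_chain2[OF bessel_phi_has_field_derivative]

text \<open>Coefficientwise this is (\<nu> + k) / \<Gamma>(\<nu> + k + 1) = 1 / \<Gamma>(\<nu> + k):
  the part with \<nu> is the first term, and the part with k cancels against k! and shifts the
  index.\<close>

lemma bessel_phi_recurrence: "\<nu> * bessel_phi \<nu> a + a * bessel_phi (\<nu> + 1) a = bessel_phi (\<nu> - 1) a"
proof -
  define t where "t = (\<lambda>\<nu> k. rGamma (\<nu> + of_nat k + 1) / fact k * a ^ k)"
  have sums: "t \<nu> sums bessel_phi \<nu> a" for \<nu>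
    using summable_sums[OF summable_bessel_phi] by (simp add: t_def bessel_phi_def)
  have "(\<lambda>k. if k = 0 then 0 else a * t (\<nu> + 1) (k - 1)) sums (a * bessel_phi (\<nu> + 1) a)"
    using sums_Suc_iff[of "\<lambda>k. if k = 0 then 0 else a * t (\<nu> + 1) (k - 1)" "a * bessel_phi (\<nu> + 1) a"]
    by (simp add: sums sums_mult)
  hence "(\<lambda>k. \<nu> * t \<nu> k + (if k = 0 then 0 else a * t (\<nu> + 1) (k - 1))) sums
           (\<nu> * bessel_phi \<nu> a + a * bessel_phi (\<nu> + 1) a)"
    by (intro sums_add sums_mult sums)
  also have "(\<lambda>k. \<nu> * t \<nu> k + (if k = 0 then 0 else a * t (\<nu> + 1) (k - 1))) = t (\<nu> - 1)"
  proof
    fix k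
    have "rGamma (\<nu> + of_nat k) = (\<nu> + of_nat k) * rGamma (\<nu> + of_nat k + 1)"
      by (simp add: rGamma_plus1)
    thus "\<nu> * t \<nu> k + (if k = 0 then 0 else a * t (\<nu> + 1) (k - 1)) = t (\<nu> - 1) k"
      by (cases k) (simp_all add: t_def field_simps del: of_nat_Suc, simp_all add: algebra_simps)
  qed
  finally show ?thesis using sums sums_unique2 by blast
qed

subsection \<open>Comparison with the series\<close>

lemma tendsto_powr_at_right_0:
  fixes s :: real
  assumes "s > 0"
  shows "((\<lambda>t. t powr s) \<longlongrightarrow> 0) (at_right 0)"
proof -
  have "((\<lambda>t. t powr s) \<longlongrightarrow> 0 powr s) (at_right 0)"
    using assms by (intro tendsto_powr2)
      (auto intro!: tendsto_intros eventually_at_right_less[THEN eventually_mono] simp: less_imp_le)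
  thus ?thesis by simp
qed

text \<open>An energy estimate with integrating factor exp (- \<Lambda>). The coefficients K and L
  may blow up at 0, as long as their antiderivative \<Lambda> has a finite limit there; then the
  vanishing limits of x and y act as an initial condition.\<close>

lemma singular_linear_system_eq_0:
  fixes x y x' y' :: "real \<Rightarrow> 'a :: real_inner" and \<Lambda> K L :: "real \<Rightarrow> real"
  assumes x: "\<And>t. t > 0 \<Longrightarrow> (x has_vector_derivative x' t) (at t)"
    and y: "\<And>t. t > 0 \<Longrightarrow> (y has_vector_derivative y' t) (at t)"
    and x': "\<And>t. t > 0 \<Longrightarrow> norm (x' t) \<le> K t * norm (y t)"
    and y': "\<And>t. t > 0 \<Longrightarrow> norm (y' t) \<le> L t * norm (x t)"
    and \<Lambda>: "\<And>t. t > 0 \<Longrightarrow> (\<Lambda> has_real_derivative K t + L t) (at t)"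
    and KL: "\<And>t. t > 0 \<Longrightarrow> K t \<ge> 0" "\<And>t. t > 0 \<Longrightarrow> L t \<ge> 0"
    and lim: "(x \<longlongrightarrow> 0) (at_right 0)" "(y \<longlongrightarrow> 0) (at_right 0)" "(\<Lambda> \<longlongrightarrow> l) (at_right 0)"
    and t: "t > 0"
  shows "x t = 0"
proof -
  \<comment> \<open>\<open>E\<close> is nonnegative, tends to 0 at 0 and is nonincreasing, because
    the cross terms are at most 2 (K + L) |x| |y| \<le> (K + L) (|x|^2 + |y|^2).\<close>
  define E where "E = (\<lambda>t. (x t \<bullet> x t + y t \<bullet> y t) * exp (- \<Lambda> t))"
  have inner: "((\<lambda>t. f t \<bullet> f t) has_real_derivative 2 * (f t \<bullet> f' t)) (at t)"
    if "(f has_vector_derivative f' t) (at t)" for f f' :: "real \<Rightarrow> 'a" and t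
    using that unfolding has_vector_derivative_def has_field_derivative_def
    by (auto intro!: derivative_eq_intros simp: fun_eq_iff inner_commute algebra_simps)
  have deriv: "(E has_real_derivative
      (2 * (x t \<bullet> x' t) + 2 * (y t \<bullet> y' t) - (K t + L t) * (x t \<bullet> x t + y t \<bullet> y t)) * exp (- \<Lambda> t)) (at t)"
    if "t > 0" for t
    unfolding E_def using inner[where f = x] inner[where f = y] x[OF that] y[OF that] \<Lambda>[OF that]
    by (auto intro!: derivative_eq_intros simp: algebra_simps)
  have nonpos: "(2 * (x t \<bullet> x' t) + 2 * (y t \<bullet> y' t) - (K t + L t) * (x t \<bullet> x t + y t \<bullet> y t)) * exp (- \<Lambda> t) \<le> 0"
    if "t > 0" for t
  proof -
    have "x t \<bullet> x' t \<le> norm (x t) * norm (x' t)" by (rule norm_cauchy_schwarz)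
    also have "\<dots> \<le> norm (x t) * (K t * norm (y t))" using x'[OF that] by (rule mult_left_mono) auto
    finally have 1: "x t \<bullet> x' t \<le> K t * (norm (x t) * norm (y t))" by (simp add: mult_ac)
    have "y t \<bullet> y' t \<le> norm (y t) * norm (y' t)" by (rule norm_cauchy_schwarz)
    also have "\<dots> \<le> norm (y t) * (L t * norm (x t))" using y'[OF that] by (rule mult_left_mono) auto
    finally have 2: "y t \<bullet> y' t \<le> L t * (norm (x t) * norm (y t))" by (simp add: mult_ac)
    have "(K t + L t) * (2 * (norm (x t) * norm (y t))) \<le> (K t + L t) * (x t \<bullet> x t + y t \<bullet> y t)"
      using KL[OF that] sum_squares_bound[of "norm (x t)" "norm (y t)"]
      by (intro mult_left_mono) (auto simp: dot_square_norm)
    with 1 2 have "2 * (x t \<bullet> x' t) + 2 * (y t \<bullet> y' t) - (K t + L t) * (x t \<bullet> x t + y t \<bullet> y t) \<le> 0"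
      by (simp add: algebra_simps)
    thus ?thesis by (simp add: mult_nonpos_nonneg)
  qed
  have mono: "E t \<le> E s" if "0 < s" "s \<le> t" for s
  proof (rule DERIV_nonpos_imp_nonincreasing[OF that(2)])
    fix u assume "s \<le> u" "u \<le> t"
    hence "u > 0" using that by linarith
    from deriv[OF this] nonpos[OF this] show "\<exists>d. (E has_real_derivative d) (at u) \<and> d \<le> 0" by blast
  qed
  have "(E \<longlongrightarrow> ((0 :: 'a) \<bullet> 0 + (0 :: 'a) \<bullet> 0) * exp (- l)) (at_right 0)"
    unfolding E_def by (intro tendsto_intros tendsto_inner lim)
  moreover have "eventually (\<lambda>s. E t \<le> E s) (at_right 0)"
    using eventually_at_right_real[OF t] by eventually_elim (auto intro: mono)
  ultimately have "E t \<le> 0"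
    by (intro tendsto_lowerbound[of E _ "at_right 0"]) auto
  hence "x t \<bullet> x t + y t \<bullet> y t \<le> 0"
    by (simp add: E_def mult_le_0_iff)
  hence "x t \<bullet> x t = 0"
    using inner_ge_zero[of "x t"] inner_ge_zero[of "y t"] by linarith
  thus ?thesis by simp
qed

text \<open>For noninteger \<nu> and b = r^2 this is 2 K(2 c r) / r^\<nu> of order \<nu>, written
  out with the series of I; division by r^\<nu> removes the power of b from one term and doubles its
  exponent in the other. At integer \<nu> the division by zero makes it 0.\<close>

definition macdonald_series :: "complex \<Rightarrow> complex \<Rightarrow> complex \<Rightarrow> complex" where
  "macdonald_series \<nu> c b = of_real pi / sin (of_real pi * \<nu>) *
     (c powr (- \<nu>) * b powr (- \<nu>) * bessel_phi (- \<nu>) (c\<^sup>2 * b) - c powr \<nu> * bessel_phi \<nu> (c\<^sup>2 * b))"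

lemma sin_pi_times_plus_1: "sin (complex_of_real pi * (\<nu> + 1)) = - sin (of_real pi * \<nu>)"
  by (simp add: distrib_left sin_add sin_of_real cos_of_real)

text \<open>On the term with b^(-\<nu>), the product rule yields exactly the left side of the
  recurrence at order -\<nu>. The sign comes from sin (pi (\<nu> + 1)) = - sin (pi \<nu>). At
  integer orders both sides are 0.\<close>

lemma macdonald_series_has_field_derivative:
  assumes "b \<notin> \<real>\<^sub>\<le>\<^sub>0" "c \<noteq> 0"
  shows "(macdonald_series \<nu> c has_field_derivative - c * macdonald_series (\<nu> + 1) c b) (at b)"
proof -
  have b: "b \<noteq> 0" using assms by auto
  define k where "k = complex_of_real pi / sin (of_real pi * \<nu>)"
  have rec: "- \<nu> * bessel_phi (- \<nu>) (c\<^sup>2 * b) + c\<^sup>2 * b * bessel_phi (- \<nu> + 1) (c\<^sup>2 * b) = bessel_phi (- \<nu> - 1) (c\<^sup>2 * b)"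
    by (rule bessel_phi_recurrence)
  have k': "of_real pi / sin (complex_of_real pi * (\<nu> + 1)) = - k"
    by (simp add: sin_pi_times_plus_1 k_def)
  have "(macdonald_series \<nu> c has_field_derivative
     k * (c powr (- \<nu>) * (- \<nu> * b powr (- \<nu> - 1) * bessel_phi (- \<nu>) (c\<^sup>2 * b) +
            b powr (- \<nu>) * (bessel_phi (- \<nu> + 1) (c\<^sup>2 * b) * c\<^sup>2)) -
          c powr \<nu> * (bessel_phi (\<nu> + 1) (c\<^sup>2 * b) * c\<^sup>2))) (at b)"
    unfolding macdonald_series_def[abs_def] k_def[symmetric]
    by (rule derivative_eq_intros refl assms | simp)+ (simp add: algebra_simps)
  also have "c powr (- \<nu>) * (- \<nu> * b powr (- \<nu> - 1) * bessel_phi (- \<nu>) (c\<^sup>2 * b) +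
            b powr (- \<nu>) * (bessel_phi (- \<nu> + 1) (c\<^sup>2 * b) * c\<^sup>2)) =
          c powr (- \<nu>) * b powr (- \<nu> - 1) * bessel_phi (- \<nu> - 1) (c\<^sup>2 * b)"
    unfolding rec[symmetric] using b by (simp add: powr_diff field_simps)
  also have "k * (c powr (- \<nu>) * b powr (- \<nu> - 1) * bessel_phi (- \<nu> - 1) (c\<^sup>2 * b) -
          c powr \<nu> * (bessel_phi (\<nu> + 1) (c\<^sup>2 * b) * c\<^sup>2)) = - c * macdonald_series (\<nu> + 1) c b"
  proof -
    have 1: "c powr (- (\<nu> + 1)) = c powr (- \<nu>) / c" "c powr (\<nu> + 1) = c powr \<nu> * c" "- (\<nu> + 1) = - \<nu> - 1"
      using assms by (simp_all add: powr_diff powr_add)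
    show ?thesis
      unfolding macdonald_series_def k' 1(1,2) unfolding 1(3) using assms
      by (simp add: field_simps power2_eq_square)
  qed
  finally show ?thesis .
qed

lemma macdonald_series_minus_order:
  assumes "b \<noteq> 0"
  shows "macdonald_series \<nu> c b = b powr (- \<nu>) * macdonald_series (- \<nu>) c b"
proof -
  have "of_real pi / sin (of_real pi * (- \<nu>)) = - (of_real pi / sin (complex_of_real pi * \<nu>))" by simp
  moreover have "b powr \<nu> * b powr (- \<nu>) = 1" using assms by (simp add: powr_minus)
  ultimately show ?thesis
    unfolding macdonald_series_def by (simp add: algebra_simps)
qed

lemma sin_pi_times_eq_0_iff: "sin (complex_of_real pi * \<nu>) = 0 \<longleftrightarrow> \<nu> \<in> \<int>"
  using sin_eq_0[of "complex_of_real pi * \<nu>"] by (auto simp: Ints_def mult.commute)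

text \<open>Re \<nu> < 0 kills the term with b^(-\<nu>); the other one is evaluated by the
  reflection formula, where Re \<nu> > -1 keeps 1 + \<nu> off the poles of \<Gamma>. The limit is
  the one found for the integral.\<close>

lemma tendsto_macdonald_series_at_right_0:
  assumes "- 1 < Re \<nu>" "Re \<nu> < 0"
  shows "((\<lambda>b. macdonald_series \<nu> c (of_real b)) \<longlongrightarrow> Gamma (- \<nu>) * c powr \<nu>) (at_right 0)"
proof -
  have \<nu>: "\<nu> \<notin> \<int>"
  proof
    assume "\<nu> \<in> \<int>"
    then obtain n where "\<nu> = of_int n" by (auto elim: Ints_cases)
    thus False using assms by simp
  qed
  have cont: "((\<lambda>b. bessel_phi \<mu> (c\<^sup>2 * of_real b)) \<longlongrightarrow> bessel_phi \<mu> (c\<^sup>2 * of_real 0)) (at_right 0)" for \<mu>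
    by (rule isCont_tendsto_compose[OF DERIV_isCont[OF bessel_phi_has_field_derivative]])
       (intro tendsto_intros)
  have powr0: "((\<lambda>b. complex_of_real b powr (- \<nu>)) \<longlongrightarrow> 0) (at_right 0)"
  proof (rule tendsto_norm_zero_cancel)
    have "((\<lambda>b. b powr (- Re \<nu>)) \<longlongrightarrow> 0) (at_right 0)"
      using assms by (intro tendsto_powr_at_right_0) auto
    also have "?this \<longleftrightarrow> ((\<lambda>b. norm (complex_of_real b powr (- \<nu>))) \<longlongrightarrow> 0) (at_right 0)"
      by (intro filterlim_cong refl eventually_at_right_less[THEN eventually_mono])
         (auto simp: norm_powr_real_powr)
    finally show "((\<lambda>b. norm (complex_of_real b powr (- \<nu>))) \<longlongrightarrow> 0) (at_right 0)" .
  qed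
  have "((\<lambda>b. macdonald_series \<nu> c (of_real b)) \<longlongrightarrow> of_real pi / sin (of_real pi * \<nu>) *
     (c powr (- \<nu>) * 0 * bessel_phi (- \<nu>) (c\<^sup>2 * of_real 0) - c powr \<nu> * bessel_phi \<nu> (c\<^sup>2 * of_real 0))) (at_right 0)"
    unfolding macdonald_series_def by (intro tendsto_intros powr0 cont) (use \<nu> in \<open>auto simp: sin_pi_times_eq_0_iff\<close>)
  also have "of_real pi / sin (of_real pi * \<nu>) *
     (c powr (- \<nu>) * 0 * bessel_phi (- \<nu>) (c\<^sup>2 * of_real 0) - c powr \<nu> * bessel_phi \<nu> (c\<^sup>2 * of_real 0)) = Gamma (- \<nu>) * c powr \<nu>"
  proof -
    have "Gamma (- \<nu>) * Gamma (1 + \<nu>) = of_real pi / sin (of_real pi * (- \<nu>))"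
      using Gamma_reflection_complex[of "- \<nu>"] by simp
    moreover have "Gamma (1 + \<nu>) \<noteq> 0"
      using assms by (subst Gamma_eq_zero_iff) (auto elim!: nonpos_Ints_cases simp: complex_eq_iff)
    hence "Gamma (- \<nu>) * Gamma (1 + \<nu>) * rGamma (\<nu> + 1) = Gamma (- \<nu>)"
      by (simp add: rGamma_inverse_Gamma add.commute)
    ultimately have "Gamma (- \<nu>) = - of_real pi / sin (of_real pi * \<nu>) * rGamma (\<nu> + 1)"
      by simp
    thus ?thesis by (simp add: bessel_phi_0)
  qed
  finally show ?thesis .
qed

text \<open>Off the real axis |\<mu> + n| \<ge> |Im \<mu>| \<ge> \<delta> for every n, so repeated
  use of the functional equation bounds \<open>rGamma (\<mu> + of_nat n)\<close> by B / \<delta>^n,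
  and an exponential series is a majorant. Such orders suffice to reach the punctured imaginary axis
  from the strip.\<close>

lemma isCont_bessel_phi_order:
  assumes "Im \<nu> \<noteq> 0"
  shows "isCont (\<lambda>\<nu>. bessel_phi \<nu> a) \<nu>"
proof -
  define \<delta> where "\<delta> = \<bar>Im \<nu>\<bar> / 2"
  have \<delta>: "\<delta> > 0" using assms by (simp add: \<delta>_def)
  have Im: "\<delta> \<le> \<bar>Im \<mu>\<bar>" if "\<mu> \<in> cball \<nu> \<delta>" for \<mu>
    proof -
    have "\<bar>Im \<nu> - Im \<mu>\<bar> \<le> \<delta>"
      using that abs_Im_le_cmod[of "\<nu> - \<mu>"] by (simp add: dist_norm)
    thus ?thesis unfolding \<delta>_def by linarith
  qed
  have "bounded (rGamma ` cball \<nu> \<delta>)"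
    by (intro compact_imp_bounded compact_continuous_image continuous_on_rGamma compact_cball)
  then obtain B where B: "norm (rGamma \<mu>) \<le> B" if "\<mu> \<in> cball \<nu> \<delta>" for \<mu>
    unfolding bounded_iff by fast
  have rG: "norm (rGamma (\<mu> + of_nat n)) \<le> B / \<delta> ^ n" if \<mu>: "\<mu> \<in> cball \<nu> \<delta>" for \<mu> n
  proof (induction n)
    case 0
    thus ?case using B[OF \<mu>] by simp
  next
    case (Suc n)
    have "rGamma (\<mu> + of_nat n) = (\<mu> + of_nat n) * rGamma (\<mu> + of_nat (Suc n))"
      using rGamma_plus1[of "\<mu> + of_nat n"] by (simp add: algebra_simps)
    hence "norm (rGamma (\<mu> + of_nat n)) = norm (\<mu> + of_nat n) * norm (rGamma (\<mu> + of_nat (Suc n)))"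
      by (simp add: norm_mult)
    also have "\<delta> \<le> norm (\<mu> + of_nat n)"
      using Im[OF \<mu>] abs_Im_le_cmod[of "\<mu> + of_nat n"] by simp
    hence "norm (\<mu> + of_nat n) * norm (rGamma (\<mu> + of_nat (Suc n))) \<ge> \<delta> * norm (rGamma (\<mu> + of_nat (Suc n)))"
      by (rule mult_right_mono) simp
    finally have "\<delta> * norm (rGamma (\<mu> + of_nat (Suc n))) \<le> B / \<delta> ^ n"
      using Suc.IH by (rule order_trans)
    thus ?case using \<delta> by (simp add: field_simps del: of_nat_Suc)
  qed
  define M where "M = (\<lambda>k. B / \<delta> * (inverse (fact k) * (norm a / \<delta>) ^ k))"
  have "uniform_limit (ball \<nu> \<delta>) (\<lambda>n \<mu>. \<Sum>k<n. rGamma (\<mu> + of_nat k + 1) / fact k * a ^ k)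
          (\<lambda>\<mu>. bessel_phi \<mu> a) sequentially"
    unfolding bessel_phi_def
  proof (rule Weierstrass_m_test)
    fix k \<mu> assume "\<mu> \<in> ball \<nu> \<delta>"
    hence "norm (rGamma (\<mu> + of_nat (k + 1))) \<le> B / \<delta> ^ (k + 1)"
      by (intro rG) (auto simp: less_imp_le)
    hence "norm (rGamma (\<mu> + of_nat (k + 1))) * (norm a ^ k / fact k) \<le> B / \<delta> ^ (k + 1) * (norm a ^ k / fact k)"
      by (rule mult_right_mono) auto
    also have "\<dots> = M k"
      by (simp add: M_def divide_inverse power_mult_distrib power_inverse)
    finally show "norm (rGamma (\<mu> + of_nat k + 1) / fact k * a ^ k) \<le> M k"
      by (simp add: norm_mult norm_divide norm_power add_ac)
  next
    show "summable M"
      unfolding M_def by (intro summable_mult summable_exp)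
  qed
  moreover have "continuous_on (ball \<nu> \<delta>) (\<lambda>\<mu>. rGamma (\<mu> + of_nat k + 1))" for k
    by (rule continuous_on_compose2[OF continuous_on_rGamma[of UNIV]]) (auto intro!: continuous_intros)
  hence "continuous_on (ball \<nu> \<delta>) (\<lambda>\<mu>. \<Sum>k<n. rGamma (\<mu> + of_nat k + 1) / fact k * a ^ k)" for n
    by (intro continuous_on_sum continuous_on_mult continuous_on_divide continuous_on_const) auto
  ultimately have "continuous_on (ball \<nu> \<delta>) (\<lambda>\<mu>. bessel_phi \<mu> a)"
    by (intro uniform_limit_theorem[of _ "\<lambda>n \<mu>. \<Sum>k<n. rGamma (\<mu> + of_nat k + 1) / fact k * a ^ k"]) auto
  moreover have "\<nu> \<in> interior (ball \<nu> \<delta>)"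
    using \<delta> by (simp add: interior_open)
  ultimately show ?thesis
    by (rule continuous_on_interior)
qed

lemma macdonald_difference_has_vector_derivative:
  assumes "Re c > 0" "t > 0"
  shows "((\<lambda>t. macdonald_integral \<nu> c (c * of_real t) - macdonald_series \<nu> c (complex_of_real t)) has_vector_derivative
           - c * (macdonald_integral (\<nu> + 1) c (c * of_real t) - macdonald_series (\<nu> + 1) c (complex_of_real t))) (at t)"
proof -
  have "c \<noteq> 0" using assms by auto
  hence "((\<lambda>t. macdonald_integral \<nu> c (c * t) - macdonald_series \<nu> c t) has_field_derivative
          - macdonald_integral (\<nu> + 1) c (c * of_real t) * c - (- c * macdonald_series (\<nu> + 1) c (of_real t))) (at (of_real t))"
    using assms
    by (intro DERIV_diff macdonald_series_has_field_derivative
          DERIV_chain2[OF macdonald_integral_has_field_derivative]) (auto intro!: derivative_eq_intros)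
  from has_vector_derivative_real_field[OF this, of UNIV] show ?thesis
    by (simp add: algebra_simps)
qed

lemma macdonald_difference_minus_order:
  assumes "Re c > 0" "t > 0"
  shows "macdonald_integral \<nu> c (c * of_real t) - macdonald_series \<nu> c (complex_of_real t) =
         of_real t powr (- \<nu>) * (macdonald_integral (- \<nu>) c (c * of_real t) - macdonald_series (- \<nu>) c (complex_of_real t))"
  using assms
  by (subst macdonald_integral_minus_order, simp, simp, subst macdonald_series_minus_order) (simp_all add: algebra_simps)

text \<open>
  By the order reflection, the derivative \<open>- c D (\<nu> + 1)\<close> of \<open>D \<nu>\<close>, the difference of both
  sides, is a multiple of \<open>D (- 1 - \<nu>)\<close>. The strip \<open>-1 < Re \<nu> < 0\<close> is invariant under
  \<open>\<nu> \<mapsto> - 1 - \<nu>\<close>, and on it both differences vanish at the singular point \<open>0\<close>.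
\<close>
lemma macdonald_integral_eq_series_strip:
  assumes c: "Re c > 0" and "- 1 < Re \<nu>" "Re \<nu> < 0" and "b > 0"
  shows "macdonald_integral \<nu> c (c * of_real b) = macdonald_series \<nu> c (of_real b)"
proof -
  define D where "D = (\<lambda>\<nu> b. macdonald_integral \<nu> c (c * of_real b) - macdonald_series \<nu> c (complex_of_real b))"
  have c0: "c \<noteq> 0" using c by auto
  have deriv: "(D \<mu> has_vector_derivative - c * D (\<mu> + 1) t) (at t)" if "t > 0" for \<mu> t
    unfolding D_def using macdonald_difference_has_vector_derivative[OF c that] .
  have sym: "D \<mu> t = of_real t powr (- \<mu>) * D (- \<mu>) t" if "t > 0" for \<mu> t
    unfolding D_def using macdonald_difference_minus_order[OF c that] .
  have lim: "(D \<mu> \<longlongrightarrow> 0) (at_right 0)" if "- 1 < Re \<mu>" "Re \<mu> < 0" for \<mu>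
    using tendsto_diff[OF tendsto_macdonald_integral_at_right_0[of \<mu> c] tendsto_macdonald_series_at_right_0[of \<mu> c]] that c
    by (simp add: D_def)
  define \<sigma> where "\<sigma> = Re \<nu>"
  have \<sigma>: "- 1 < \<sigma>" "\<sigma> < 0" using assms by (auto simp: \<sigma>_def)
  \<comment> \<open>Reflection replaces D (\<nu> + 1) by t^(-\<nu> - 1) D (-1 - \<nu>), and D
    (-\<nu>) by t^\<nu> D \<nu>. The moduli t^(-\<sigma> - 1) and t^\<sigma> are both integrable at
    0 exactly for -1 < \<sigma> < 0; this is what fixes the strip.\<close>
  define K where "K = (\<lambda>s t. norm c * t powr s)"
  have "D \<nu> b = 0"
  proof (rule singular_linear_system_eq_0[where x = "D \<nu>" and y = "D (- 1 - \<nu>)" and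
           x' = "\<lambda>t. - c * D (\<nu> + 1) t" and y' = "\<lambda>t. - c * D (- 1 - \<nu> + 1) t" and
           K = "K (- \<sigma> - 1)" and L = "K \<sigma>" and
           \<Lambda> = "\<lambda>t. norm c * (t powr (- \<sigma>) / (- \<sigma>) + t powr (\<sigma> + 1) / (\<sigma> + 1))"])
    fix t :: real assume t: "t > 0"
    show "(D \<nu> has_vector_derivative - c * D (\<nu> + 1) t) (at t)"
         "(D (- 1 - \<nu>) has_vector_derivative - c * D (- 1 - \<nu> + 1) t) (at t)"
      by (rule deriv[OF t])+
    show "norm (- c * D (\<nu> + 1) t) \<le> K (- \<sigma> - 1) t * norm (D (- 1 - \<nu>) t)"
      using t by (subst sym) (auto simp: norm_mult norm_powr_real_powr K_def \<sigma>_def minus_diff_commute mult_ac)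
    show "norm (- c * D (- 1 - \<nu> + 1) t) \<le> K \<sigma> t * norm (D \<nu> t)"
      using t by (subst sym) (auto simp: norm_mult norm_powr_real_powr K_def \<sigma>_def algebra_simps)
    show "((\<lambda>t. norm c * (t powr (- \<sigma>) / (- \<sigma>) + t powr (\<sigma> + 1) / (\<sigma> + 1))) has_real_derivative
             K (- \<sigma> - 1) t + K \<sigma> t) (at t)"
    proof -
      have "((\<lambda>t. t powr s / s) has_real_derivative t powr (s - 1)) (at t)" if "s \<noteq> 0" for s
        using t that by (auto intro!: derivative_eq_intros)
      from DERIV_cmult[OF DERIV_add[OF this[of "- \<sigma>"] this[of "\<sigma> + 1"]], of "norm c"] show ?thesis
        using \<sigma> by (simp add: K_def distrib_left)
    qed
    show "K (- \<sigma> - 1) t \<ge> 0" "K \<sigma> t \<ge> 0" by (simp_all add: K_def)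
  next
    show "((\<lambda>t. norm c * (t powr (- \<sigma>) / (- \<sigma>) + t powr (\<sigma> + 1) / (\<sigma> + 1))) \<longlongrightarrow>
             norm c * (0 / (- \<sigma>) + 0 / (\<sigma> + 1))) (at_right 0)"
      using \<sigma> by (intro tendsto_intros tendsto_powr_at_right_0) auto
  qed (use assms in \<open>auto intro!: lim\<close>)
  thus ?thesis by (simp add: D_def)
qed

text \<open>Vanishing of the difference passes from \<mu> to \<mu> + 1 by differentiating in b, and
  from \<mu> to -\<mu> by reflection; integer translates of the strip, closed on the right, cover
  the rest.\<close>

lemma macdonald_integral_eq_series:
  assumes c: "Re c > 0" and "\<nu> \<notin> \<int>" and "b > 0"
  shows "macdonald_integral \<nu> c (c * of_real b) = macdonald_series \<nu> c (of_real b)"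
proof -
  define D where "D = (\<lambda>\<nu> b. macdonald_integral \<nu> c (c * of_real b) - macdonald_series \<nu> c (complex_of_real b))"
  have c0: "c \<noteq> 0" using c by auto
  have sym: "D \<mu> t = of_real t powr (- \<mu>) * D (- \<mu>) t" if "t > 0" for \<mu> t
    unfolding D_def using macdonald_difference_minus_order[OF c that] .
  \<comment> \<open>An order such as 1 + i is no integer translate of a point of the open strip, so
    the imaginary axis is added by approaching it from the left.\<close>
  have line: "D \<mu> t = 0" if "Re \<mu> = 0" "\<mu> \<noteq> 0" "t > 0" for \<mu> t
  proof -
    have Im: "Im \<mu> \<noteq> 0" using that by (auto simp: complex_eq_iff)
    \<comment> \<open>The double \<open>Suc\<close> starts at 1/2, which keeps every term strictly
      inside the strip.\<close>
    define X where "X = (\<lambda>n. \<mu> - of_real (inverse (real (Suc (Suc n)))))"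
    have X: "X \<longlonglongrightarrow> \<mu> - of_real 0"
      unfolding X_def by (intro tendsto_intros LIMSEQ_Suc[OF LIMSEQ_inverse_real_of_nat])
    have "isCont (\<lambda>\<mu>. macdonald_series \<mu> c (of_real t)) \<mu>"
    proof -
      have "sin (of_real pi * \<mu>) \<noteq> 0"
        using Im by (auto simp: sin_pi_times_eq_0_iff elim!: Ints_cases)
      moreover have "isCont (\<lambda>\<mu>. bessel_phi (- \<mu>) (c\<^sup>2 * of_real t)) \<mu>"
        using Im by (intro isCont_o2[where f = uminus and g = "\<lambda>\<mu>. bessel_phi \<mu> (c\<^sup>2 * of_real t)"]
                       isCont_bessel_phi_order isCont_minus continuous_ident) auto
      moreover have "isCont (\<lambda>\<mu>. bessel_phi \<mu> (c\<^sup>2 * of_real t)) \<mu>"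
        using Im by (rule isCont_bessel_phi_order)
      moreover have "isCont (\<lambda>\<mu>. w powr \<mu>) \<mu>" "isCont (\<lambda>\<mu>. w powr (- \<mu>)) \<mu>" if "w \<noteq> 0" for w
        using that by (auto simp: powr_def intro!: continuous_intros)
      moreover have "isCont (\<lambda>\<mu>. sin (of_real pi * \<mu>)) \<mu>"
        by (intro continuous_intros)
      ultimately show ?thesis
        unfolding macdonald_series_def using c0 that
        by (intro isCont_mult isCont_diff isCont_divide continuous_const) auto
    qed
    hence "isCont (\<lambda>\<mu>. D \<mu> t) \<mu>"
      unfolding D_def using that c by (intro isCont_diff isCont_macdonald_integral_order) auto
    hence "(\<lambda>n. D (X n) t) \<longlonglongrightarrow> D \<mu> t"
      using X by (intro isCont_tendsto_compose[where g = "\<lambda>\<mu>. D \<mu> t"]) auto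
    moreover have "D (X n) t = 0" for n
    proof -
      have "inverse (real (Suc (Suc n))) < 1" by (simp add: field_simps)
      moreover have "inverse (real (Suc (Suc n))) > 0" by simp
      moreover have "Re (X n) = - inverse (real (Suc (Suc n)))"
        using that by (simp add: X_def del: of_nat_Suc of_real_inverse)
      ultimately have "- 1 < Re (X n)" "Re (X n) < 0"
        by linarith+
      thus ?thesis
        using macdonald_integral_eq_series_strip[OF c _ _ \<open>t > 0\<close>] by (simp add: D_def)
    qed
    ultimately show ?thesis by (simp add: LIMSEQ_const_iff)
  qed
  have strip: "D \<mu> t = 0" if "- 1 < Re \<mu>" "Re \<mu> \<le> 0" "\<mu> \<noteq> 0" "t > 0" for \<mu> t
    using macdonald_integral_eq_series_strip[OF c, of \<mu> t] line[of \<mu> t] that by (cases "Re \<mu> = 0") (auto simp: D_def)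
  \<comment> \<open>The difference vanishes for all t > 0, hence so does its derivative, which is -c
    times the difference of the next order.\<close>
  have step: "D (\<mu> + 1) t = 0" if D0: "\<And>t. t > 0 \<Longrightarrow> D \<mu> t = 0" and t: "t > 0" for \<mu> t
  proof -
    have "(D \<mu> has_vector_derivative - c * D (\<mu> + 1) t) (at t)"
      unfolding D_def using macdonald_difference_has_vector_derivative[OF c t] .
    moreover have "(D \<mu> has_vector_derivative 0) (at t)"
      by (rule has_vector_derivative_transform_within_open[of "\<lambda>_. 0" _ _ "{0<..}"]) (use D0 t in auto)
    ultimately have "- c * D (\<mu> + 1) t = 0" by (rule vector_derivative_unique_at)
    thus ?thesis using c0 by simp
  qed
  have iter: "D (\<mu> + of_nat n) t = 0" if "- 1 < Re \<mu>" "Re \<mu> \<le> 0" "\<mu> \<noteq> 0" "t > 0" for \<mu> n t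
    using that
  proof (induction n arbitrary: t)
    case (Suc n)
    thus ?case using step[of "\<mu> + of_nat n" t] by (simp add: add_ac)
  qed (auto intro: strip)
  have right: "D \<mu> t = 0" if "\<mu> \<notin> \<int>" "Re \<mu> \<ge> 0" "t > 0" for \<mu> t
  proof -
    \<comment> \<open>Rounding up puts the real part of \<mu> - n into (-1, 0]; the value 0 is
      excluded because \<mu> is not an integer.\<close>
    define n where "n = nat \<lceil>Re \<mu>\<rceil>"
    have "\<mu> - of_nat n \<noteq> 0" using that by auto
    moreover have "- 1 < Re (\<mu> - of_nat n)" "Re (\<mu> - of_nat n) \<le> 0"
      using that unfolding n_def by (simp; linarith)+
    ultimately have "D (\<mu> - of_nat n + of_nat n) t = 0"
      by (intro iter that)
    thus ?thesis by simp
  qed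
  have "D \<nu> b = 0"
  proof (cases "Re \<nu> \<ge> 0")
    case False
    hence "D (- \<nu>) b = 0" using assms by (intro right) auto
    thus ?thesis using sym[OF \<open>b > 0\<close>, of \<nu>] by simp
  qed (use right assms in auto)
  thus ?thesis by (simp add: D_def)
qed

section \<open>Identification with \<open>bessel_K\<close> at all orders\<close>

lemma bessel_I_altdef: "bessel_I \<nu> z = (z / 2) powr \<nu> * bessel_phi \<nu> (z\<^sup>2 / 4)"
  by (simp add: bessel_I_def bessel_phi_def mult_ac)

text \<open>At integer order the limit in the definition is read off from the integral, which is
  continuous in the order; the logarithmic expansion of K never appears.\<close>

lemma bessel_K_eq_macdonald_integral:
  assumes k: "Re k > 0" and r: "r > 0"
  shows "bessel_K \<nu> (k * of_real r) / of_real r powr \<nu> = macdonald_integral \<nu> (k / 2) (k / 2 * of_real (r\<^sup>2)) / 2"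
proof -
  define c where "c = k / 2"
  have c: "Re c > 0" using k by (simp add: c_def)
  define Q where "Q = (\<lambda>\<mu>. of_real pi / 2 * (bessel_I (- \<mu>) (k * of_real r) - bessel_I \<mu> (k * of_real r)) / sin (\<mu> * of_real pi))"
  define g where "g = (\<lambda>\<mu>. of_real r powr \<mu> * macdonald_integral \<mu> c (c * of_real (r\<^sup>2)) / 2)"
  have Q: "Q \<mu> = g \<mu>" if "\<mu> \<notin> \<int>" for \<mu>
  proof -
    have I: "bessel_I \<mu> (k * of_real r) = of_real r powr \<mu> * c powr \<mu> * bessel_phi \<mu> (c\<^sup>2 * of_real (r\<^sup>2))" for \<mu>
    proof -
      have "k * of_real r / 2 = of_real r * c" "(k * of_real r)\<^sup>2 / 4 = c\<^sup>2 * of_real (r\<^sup>2)"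
        by (simp_all add: c_def field_simps)
      moreover have "(of_real r * c) powr \<mu> = of_real r powr \<mu> * c powr \<mu>"
        using r by (intro powr_times_real_left) auto
      ultimately show ?thesis by (simp only: bessel_I_altdef)
    qed
    have "of_real (r\<^sup>2) powr (- \<mu>) = of_real r powr (- \<mu>) * (of_real r powr (- \<mu>) :: complex)"
      using r by (simp add: power2_eq_square powr_times_real)
    moreover have "of_real r powr \<mu> * of_real r powr (- \<mu>) = (1 :: complex)"
      using r by (simp add: powr_minus)
    ultimately have pw: "of_real r powr \<mu> * of_real (r\<^sup>2) powr (- \<mu>) = (of_real r powr (- \<mu>) :: complex)"
      by (simp add: algebra_simps)
    have "g \<mu> = of_real r powr \<mu> * macdonald_series \<mu> c (of_real (r\<^sup>2)) / 2"
      unfolding g_def using c that r by (subst macdonald_integral_eq_series) auto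
    also have "\<dots> = of_real pi / sin (of_real pi * \<mu>) / 2 *
       (c powr (- \<mu>) * (of_real r powr \<mu> * of_real (r\<^sup>2) powr (- \<mu>)) * bessel_phi (- \<mu>) (c\<^sup>2 * of_real (r\<^sup>2))
         - of_real r powr \<mu> * c powr \<mu> * bessel_phi \<mu> (c\<^sup>2 * of_real (r\<^sup>2)))"
      by (simp add: macdonald_series_def algebra_simps add_divide_distrib diff_divide_distrib)
    also have "\<dots> = Q \<mu>"
      unfolding Q_def I pw by (simp add: algebra_simps add_divide_distrib diff_divide_distrib)
    finally show ?thesis ..
  qed
  have "bessel_K \<nu> (k * of_real r) = g \<nu>"
  proof (cases "\<nu> \<in> \<int>")
    case True
    have "isCont g \<nu>"
      unfolding g_def powr_def using c r
      by (auto intro!: isCont_mult isCont_divide isCont_macdonald_integral_order continuous_intros simp: zero_less_mult_iff)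
    hence "(g \<longlongrightarrow> g \<nu>) (at \<nu>)" by (simp add: isCont_def)
    also have "?this \<longleftrightarrow> (Q \<longlongrightarrow> g \<nu>) (at \<nu>)"
    proof (intro filterlim_cong refl)
      \<comment> \<open>Distinct integers are at distance at least 1, so near an integer order the
        quotient agrees with the integral except at the order itself.\<close>
      have "\<mu> \<notin> \<int>" if "dist \<mu> \<nu> < 1" "\<mu> \<noteq> \<nu>" for \<mu>
      proof
        assume "\<mu> \<in> \<int>"
        then obtain m n where mn: "\<mu> = of_int m" "\<nu> = of_int n" using True by (auto elim!: Ints_cases)
        hence "norm (of_int (m - n) :: complex) < 1" using that by (simp add: dist_norm)
        hence "m = n" by (simp del: of_int_diff)
        thus False using that mn by simp
      qed
      thus "\<forall>\<^sub>F \<mu> in at \<nu>. g \<mu> = Q \<mu>"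
        unfolding eventually_at by (intro exI[of _ 1]) (auto simp: Q)
    qed
    finally have "Lim (at \<nu>) Q = g \<nu>" by (intro tendsto_Lim) auto
    thus ?thesis using True unfolding bessel_K_def Q_def by (simp add: Let_def)
  next
    case False
    thus ?thesis using Q[of \<nu>] unfolding bessel_K_def Q_def by (simp add: Let_def)
  qed
  thus ?thesis using r by (simp add: g_def c_def)
qed

subsection \<open>Gaussian convolution\<close>

text \<open>The substitution u = x^2 reduces this to the Gamma integral of order -1/2, which already
  settles the branch of the square root for complex P; evenness supplies the negative half
  line.\<close>

lemma has_bochner_integral_complex_gaussian_real:
  assumes P: "Re P > 0"
  shows "has_bochner_integral lborel (\<lambda>x::real. exp (- (P * of_real (x\<^sup>2)))) (of_real (sqrt pi) * P powr (- (1 / 2)))"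
proof -
  define f where "f = macdonald_integrand (- (1 / 2)) P 0"
  define I where "I = of_real (sqrt pi) * P powr (- (1 / 2))"
  have int: "integrable lborel f"
    unfolding f_def using P by (intro integrable_macdonald_integrand_Re_less_0) auto
  have f0: "(\<lambda>u. indicator {0<..} u *\<^sub>R f u) = f"
    by (auto simp: f_def macdonald_integrand_def indicator_def fun_eq_iff)
  have abs_int: "f absolutely_integrable_on {0<..}"
    unfolding set_integrable_def f0 using int by (subst integrable_completion) (auto simp: f_def)
  have "integral {0<..} f = set_lebesgue_integral lebesgue {0<..} f"
    using set_lebesgue_integral_eq_integral(2)[OF abs_int] by simp
  also have "\<dots> = macdonald_integral (- (1 / 2)) P 0"
    unfolding set_lebesgue_integral_def f0 macdonald_integral_def f_def[symmetric]
    by (rule integral_completion) (simp add: f_def)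
  also have "\<dots> = I"
    using P by (subst macdonald_integral_0_right) (auto simp: I_def Gamma_one_half_complex)
  finally have intf: "integral {0<..} f = I" .
  have img: "(\<lambda>x. x\<^sup>2) ` {0<..} = ({0<..} :: real set)"
  proof (intro equalityI subsetI)
    fix x :: real assume "x \<in> {0<..}"
    thus "x \<in> (\<lambda>x. x\<^sup>2) ` {0<..}" by (intro image_eqI[of _ _ "sqrt x"]) auto
  qed auto
  \<comment> \<open>The 2 is what remains of the Jacobian 2 x times u^(-1/2) = 1 / x. It is divided
    out at the end.\<close>
  define g where "g = (\<lambda>x::real. 2 * exp (- (P * of_real (x\<^sup>2))))"
  have der: "((\<lambda>x::real. x\<^sup>2) has_field_derivative 2 * x) (at x within {0<..})" for x
    by (auto intro!: derivative_eq_intros)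
  have inj: "inj_on (\<lambda>x::real. x\<^sup>2) {0<..}"
    by (auto simp: inj_on_def)
  have 1: "(\<lambda>x. \<bar>2 * x\<bar> *\<^sub>R f (x\<^sup>2)) absolutely_integrable_on {0<..}"
    and 2: "integral {0<..} (\<lambda>x. \<bar>2 * x\<bar> *\<^sub>R f (x\<^sup>2)) = I"
    using has_absolute_integral_change_of_variables_real[OF _ der inj, of f I] abs_int intf
    by (simp_all add: img)
  have eq: "\<bar>2 * x\<bar> *\<^sub>R f (x\<^sup>2) = g x" if "x \<in> {0<..}" for x
  proof -
    have "complex_of_real (x\<^sup>2) powr (- (1 / 2)) = of_real ((x\<^sup>2) powr (- (1 / 2)))"
      using powr_of_real[of "x\<^sup>2" "- (1 / 2)"] by simp
    also have "(x\<^sup>2) powr (- (1 / 2)) = 1 / x"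
      using that by (simp add: powr_minus powr_half_sqrt field_simps)
    finally show ?thesis
      using that by (simp add: f_def g_def macdonald_integrand_def scaleR_conv_of_real)
  qed
  have g: "g absolutely_integrable_on {0<..}" "integral {0<..} g = I"
  proof -
    have "(\<lambda>x. indicator {0<..} x *\<^sub>R (\<bar>2 * x\<bar> *\<^sub>R f (x\<^sup>2))) = (\<lambda>x. indicator {0<..} x *\<^sub>R g x)"
      using eq by (auto simp: indicator_def fun_eq_iff)
    thus "g absolutely_integrable_on {0<..}"
      using 1 unfolding set_integrable_def by simp
    show "integral {0<..} g = I"
      using Henstock_Kurzweil_Integration.integral_cong[of "{0<..}" "\<lambda>x. \<bar>2 * x\<bar> *\<^sub>R f (x\<^sup>2)" g] eq 2 by simp
  qed
  have [measurable]: "g \<in> borel_measurable borel" by (simp add: g_def)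
  have "integrable lborel (\<lambda>x. indicator {0<..} x *\<^sub>R g x)"
    using g(1) unfolding set_integrable_def by (subst (asm) integrable_completion) auto
  moreover have "(\<integral>x. indicator {0<..} x *\<^sub>R g x \<partial>lborel) = I"
  proof -
    have "(\<integral>x. indicator {0<..} x *\<^sub>R g x \<partial>lborel) = (\<integral>x. indicator {0<..} x *\<^sub>R g x \<partial>lebesgue)"
      by (subst integral_completion) auto
    thus ?thesis
      using set_lebesgue_integral_eq_integral(2)[OF g(1)] g(2) by (simp add: set_lebesgue_integral_def)
  qed
  ultimately have "has_bochner_integral lborel (\<lambda>x. indicator {0<..} x *\<^sub>R g x) I"
    by (simp add: has_bochner_integral_iff)
  also have "?this \<longleftrightarrow> has_bochner_integral lborel (\<lambda>x. indicator {0..} x *\<^sub>R g x) I"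
    by (rule has_bochner_integral_discrete_difference[of "{0}"]) (auto simp: indicator_def)
  finally have "has_bochner_integral lborel g (2 *\<^sub>R I)"
    by (rule has_bochner_integral_even_function) (simp add: g_def)
  from has_bochner_integral_mult_right[OF this, of "1 / 2"] show ?thesis
    by (simp add: g_def I_def scaleR_conv_of_real)
qed

text \<open>The integrand is a product over the coordinates. The n-th power of P^(-1/2) is P^(-n/2)
  on the principal branch, both being exponentials of multiples of the same
  \<open>Ln P\<close>.\<close>

lemma has_bochner_integral_complex_gaussian:
  assumes P: "Re P > 0"
  shows "has_bochner_integral lborel (\<lambda>x::'a::euclidean_space. exp (- (P * of_real ((norm x)\<^sup>2))))
           (of_real (sqrt pi) ^ DIM('a) * P powr (- of_nat DIM('a) / 2))"
proof -
  define I where "I = of_real (sqrt pi) * P powr (- (1 / 2))"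
  define g where "g = (\<lambda>x::real. exp (- (P * of_real (x\<^sup>2))))"
  have g: "integrable lborel g" "integral\<^sup>L lborel g = I"
    using has_bochner_integral_complex_gaussian_real[OF P] by (auto simp: has_bochner_integral_iff g_def I_def)
  interpret product_sigma_finite "\<lambda>_. lborel :: real measure" ..
  have eq: "exp (- (P * of_real ((norm (\<Sum>b\<in>Basis. f b *\<^sub>R b :: 'a))\<^sup>2))) = (\<Prod>b\<in>Basis. g (f b))" for f :: "'a \<Rightarrow> real"
  proof -
    have "(norm (\<Sum>b\<in>Basis. f b *\<^sub>R b :: 'a))\<^sup>2 = (\<Sum>b\<in>Basis. (f b)\<^sup>2)"
      by (subst power2_norm_eq_inner, subst euclidean_inner) (simp add: power2_eq_square)
    thus ?thesis
      by (simp add: g_def sum_distrib_left exp_sum flip: sum_negf)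
  qed
  have "has_bochner_integral (\<Pi>\<^sub>M b\<in>(Basis :: 'a set). lborel) (\<lambda>f. \<Prod>b\<in>Basis. g (f b)) (\<Prod>b\<in>(Basis :: 'a set). I)"
    using product_integrable_prod[of "Basis :: 'a set" "\<lambda>_. g"] product_integral_prod[of "Basis :: 'a set" "\<lambda>_. g"] g
    by (simp add: has_bochner_integral_iff)
  hence "has_bochner_integral (\<Pi>\<^sub>M b\<in>(Basis :: 'a set). lborel)
           (\<lambda>f. exp (- (P * of_real ((norm (\<Sum>b\<in>Basis. f b *\<^sub>R b :: 'a))\<^sup>2)))) (\<Prod>b\<in>(Basis :: 'a set). I)"
    unfolding eq .
  hence "has_bochner_integral lborel (\<lambda>x::'a. exp (- (P * of_real ((norm x)\<^sup>2)))) (\<Prod>b\<in>(Basis :: 'a set). I)"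
    unfolding lborel_eq[where 'a = 'a] by (rule has_bochner_integral_distr[rotated 2]) auto
  also have "(\<Prod>b\<in>(Basis :: 'a set). I) = of_real (sqrt pi) ^ DIM('a) * P powr (- of_nat DIM('a) / 2)"
  proof -
    have "P \<noteq> 0" using P by auto
    hence "(P powr (- (1 / 2))) ^ DIM('a) = P powr (- of_nat DIM('a) / 2)"
      by (simp add: powr_def flip: exp_of_nat_mult)
    thus ?thesis by (simp add: I_def power_mult_distrib)
  qed
  finally show ?thesis .
qed

text \<open>Completing the square leaves a Gaussian of parameter c (1/u + 1/v) and the residual
  exponent c |x - y|^2 / (u + v), which depends on u and v through their sum only.\<close>

lemma has_bochner_integral_gaussian_convolution:
  fixes x y :: "'a :: euclidean_space"
  assumes c: "Re c > 0" and u: "u > 0" and v: "v > 0"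
  shows "has_bochner_integral lborel
           (\<lambda>w. exp (- (c * of_real ((norm (x - w))\<^sup>2 / u))) * exp (- (c * of_real ((norm (w - y))\<^sup>2 / v))))
           (of_real (sqrt pi) ^ DIM('a) * (c * of_real ((u + v) / (u * v))) powr (- of_nat DIM('a) / 2) *
              exp (- (c * of_real ((norm (x - y))\<^sup>2 / (u + v)))))"
proof -
  define m where "m = (v / (u + v)) *\<^sub>R x + (u / (u + v)) *\<^sub>R y"
  define P where "P = c * of_real ((u + v) / (u * v))"
  \<comment> \<open>The centre \<open>m\<close> of the completed square is real although \<open>c\<close> is complex, so the contour need not be shifted.\<close>
  have sq: "(norm (x - w))\<^sup>2 / u + (norm (w - y))\<^sup>2 / v = (u + v) / (u * v) * (norm (- m + w))\<^sup>2 + (norm (x - y))\<^sup>2 / (u + v)" for w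
  proof -
    have uv: "u + v \<noteq> 0" using u v by simp
    have "(u + v) *\<^sub>R (- m + w) = u *\<^sub>R (w - y) - v *\<^sub>R (x - w)"
      using uv by (simp add: m_def scaleR_diff_right scaleR_add_right) (simp add: algebra_simps)
    moreover have "- m + w = (1 / (u + v)) *\<^sub>R ((u + v) *\<^sub>R (- m + w))"
      using uv by simp
    ultimately have "- m + w = (1 / (u + v)) *\<^sub>R (u *\<^sub>R (w - y) - v *\<^sub>R (x - w))"
      by (simp only:)
    hence "(norm (- m + w))\<^sup>2 = (norm (u *\<^sub>R (w - y) - v *\<^sub>R (x - w)))\<^sup>2 / (u + v)\<^sup>2"
      by (simp add: power_divide)
    moreover have "(norm (u *\<^sub>R a - v *\<^sub>R b))\<^sup>2 = u\<^sup>2 * (norm a)\<^sup>2 + v\<^sup>2 * (norm b)\<^sup>2 - 2 * u * v * (a \<bullet> b)" for a b :: 'a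
      unfolding power2_norm_eq_inner
      by (simp add: inner_diff_left inner_diff_right inner_commute power2_eq_square algebra_simps)
    moreover have "(norm (x - y))\<^sup>2 = (norm (w - y))\<^sup>2 + (norm (x - w))\<^sup>2 + 2 * ((w - y) \<bullet> (x - w))"
    proof -
      have "(norm (a + b))\<^sup>2 = (norm a)\<^sup>2 + (norm b)\<^sup>2 + 2 * (a \<bullet> b)" for a b :: 'a
        unfolding power2_norm_eq_inner by (simp add: inner_add_left inner_add_right inner_commute)
      moreover have "x - y = (w - y) + (x - w)" by simp
      ultimately show ?thesis by (simp only:)
    qed
    ultimately have "(u + v) / (u * v) * (norm (- m + w))\<^sup>2 + (norm (x - y))\<^sup>2 / (u + v) =
       (u\<^sup>2 * (norm (w - y))\<^sup>2 + v\<^sup>2 * (norm (x - w))\<^sup>2 - 2 * u * v * ((w - y) \<bullet> (x - w))) / (u * v * (u + v)) +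
       ((norm (w - y))\<^sup>2 + (norm (x - w))\<^sup>2 + 2 * ((w - y) \<bullet> (x - w))) / (u + v)"
      using uv by (simp add: power2_eq_square)
    also have "\<dots> = (norm (x - w))\<^sup>2 / u + (norm (w - y))\<^sup>2 / v"
      using u v uv by (simp add: divide_simps) (simp add: algebra_simps power2_eq_square)
    finally show ?thesis ..
  qed
  have "Re P > 0" using c u v by (simp add: P_def)
  note has_bochner_integral_complex_gaussian[OF this, where 'a = 'a]
  hence "has_bochner_integral (distr lborel borel ((+) (- m))) (\<lambda>w::'a. exp (- (P * of_real ((norm w)\<^sup>2))))
     (of_real (sqrt pi) ^ DIM('a) * P powr (- of_nat DIM('a) / 2))"
    unfolding lborel_distr_plus .
  hence "has_bochner_integral lborel (\<lambda>w::'a. exp (- (P * of_real ((norm (- m + w))\<^sup>2))))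
     (of_real (sqrt pi) ^ DIM('a) * P powr (- of_nat DIM('a) / 2))"
    by (simp add: has_bochner_integral_iff integrable_distr_eq integral_distr)
  from has_bochner_integral_mult_left[OF this, of "exp (- (c * of_real ((norm (x - y))\<^sup>2 / (u + v))))"]
  show ?thesis
  proof (rule has_bochner_integral_cong[THEN iffD1, rotated -1])
    fix w :: 'a
    have "exp (- (c * of_real ((norm (x - w))\<^sup>2 / u))) * exp (- (c * of_real ((norm (w - y))\<^sup>2 / v))) =
          exp (- (c * of_real ((norm (x - w))\<^sup>2 / u + (norm (w - y))\<^sup>2 / v)))"
      by (simp add: algebra_simps flip: exp_add)
    also have "\<dots> = exp (- (P * of_real ((norm (- m + w))\<^sup>2))) * exp (- (c * of_real ((norm (x - y))\<^sup>2 / (u + v))))"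
      unfolding sq P_def by (simp add: algebra_simps flip: exp_add)
    finally show "exp (- (P * of_real ((norm (- m + w))\<^sup>2))) * exp (- (c * of_real ((norm (x - y))\<^sup>2 / (u + v)))) =
          exp (- (c * of_real ((norm (x - w))\<^sup>2 / u))) * exp (- (c * of_real ((norm (w - y))\<^sup>2 / v)))" ..
  qed (simp_all add: P_def)
qed

subsection \<open>The Beta integral\<close>

lemma (in pair_sigma_finite) integrable_times:
  fixes f g :: "_ \<Rightarrow> _ :: {real_normed_algebra, banach, second_countable_topology}"
  assumes f: "integrable M1 f" and g: "integrable M2 g"
  shows "integrable (M1 \<Otimes>\<^sub>M M2) (\<lambda>(x, y). f x * g y)"
proof (rule Fubini_integrable)
  have "integrable M1 (\<lambda>x. norm (f x) * (\<integral>y. norm (g y) \<partial>M2))"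
    using f by (intro integrable_mult_left integrable_norm)
  have [measurable]: "f \<in> borel_measurable M1" "g \<in> borel_measurable M2"
    using f g by auto
  show "(\<lambda>(x, y). f x * g y) \<in> borel_measurable (M1 \<Otimes>\<^sub>M M2)" by measurable
  show "AE x in M1. integrable M2 (\<lambda>y. case (x, y) of (x, y) \<Rightarrow> f x * g y)"
    using g by simp
  show "integrable M1 (\<lambda>x. \<integral>y. norm (case (x, y) of (x, y) \<Rightarrow> f x * g y) \<partial>M2)"
  proof (rule Bochner_Integration.integrable_bound)
    show "integrable M1 (\<lambda>x. norm (f x) * (\<integral>y. norm (g y) \<partial>M2))" by fact
    show "AE x in M1. norm (\<integral>y. norm (case (x, y) of (x, y) \<Rightarrow> f x * g y) \<partial>M2)
            \<le> norm (norm (f x) * (\<integral>y. norm (g y) \<partial>M2))"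
    proof (intro AE_I2)
      fix x
      have "(\<integral>y. norm (f x * g y) \<partial>M2) \<le> (\<integral>y. norm (f x) * norm (g y) \<partial>M2)"
        using g by (intro integral_mono integrable_norm integrable_mult_right norm_mult_ineq) auto
      thus "norm (\<integral>y. norm (case (x, y) of (x, y) \<Rightarrow> f x * g y) \<partial>M2) \<le> norm (norm (f x) * (\<integral>y. norm (g y) \<partial>M2))"
        by simp
    qed
  qed measurable
qed

lemma (in pair_sigma_finite) integral_times:
  fixes f g :: "_ \<Rightarrow> _ :: {real_normed_field, banach, second_countable_topology}"
  assumes f: "integrable M1 f" and g: "integrable M2 g"
  shows "(\<integral>(x, y). f x * g y \<partial>(M1 \<Otimes>\<^sub>M M2)) = (\<integral>x. f x \<partial>M1) * (\<integral>y. g y \<partial>M2)"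
  using integral_fst[OF integrable_times[OF assms]] f g by simp

definition beta_integral :: "complex \<Rightarrow> complex \<Rightarrow> complex" where
  "beta_integral \<alpha> \<beta> = (\<integral>t. (if 0 < t \<and> t < 1 then of_real t powr (\<alpha> - 1) * of_real (1 - t) powr (\<beta> - 1) else 0) \<partial>lborel)"

lemma lborel_integral_shift:
  fixes h :: "real \<Rightarrow> 'b :: {banach, second_countable_topology}"
  shows "(\<integral>s. h (s - u) \<partial>lborel) = (\<integral>v. h v \<partial>lborel)"
  using lborel_integral_real_affine[of 1 h "- u"] by simp

lemma lborel_integrable_shift:
  fixes h :: "real \<Rightarrow> 'b :: {banach, second_countable_topology}"
  shows "integrable lborel (\<lambda>s. h (s - u)) \<longleftrightarrow> integrable lborel h"
  using lborel_integrable_real_affine_iff[of 1 h "- u"] by simp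

text \<open>After the shear s = u + v, the substitution u = s t at fixed s gives s^(\<alpha> +
  \<beta> - 2) times the Beta integrand; the Jacobian s completes the exponent.\<close>

lemma integral_convolution_powers:
  fixes \<psi> :: "real \<Rightarrow> complex" and \<alpha> \<beta> :: complex
  assumes [measurable]: "\<psi> \<in> borel_measurable borel"
  defines "F \<equiv> (\<lambda>(u :: real, v :: real). if 0 < u \<and> 0 < v then of_real u powr (\<alpha> - 1) * of_real v powr (\<beta> - 1) * \<psi> (u + v) else 0)"
  assumes int: "integrable (lborel \<Otimes>\<^sub>M lborel) F"
  shows "integral\<^sup>L (lborel \<Otimes>\<^sub>M lborel) F =
           beta_integral \<alpha> \<beta> * (\<integral>s. (if 0 < s then of_real s powr (\<alpha> + \<beta> - 1) * \<psi> s else 0) \<partial>lborel)"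
proof -
  have [measurable]: "F \<in> borel_measurable (lborel \<Otimes>\<^sub>M lborel)"
    using int by (rule borel_measurable_integrable)
  have [measurable]: "(\<lambda>(u, s). F (u, s - u)) \<in> borel_measurable (lborel \<Otimes>\<^sub>M lborel)"
    unfolding F_def powr_def by measurable
  \<comment> \<open>The shear preserves integrability, since for each u it is a translation of the
    inner variable.\<close>
  have int': "integrable (lborel \<Otimes>\<^sub>M lborel) (\<lambda>(u, s). F (u, s - u))"
  proof (rule lborel_pair.Fubini_integrable)
    have "integrable lborel (\<lambda>u. \<integral>v. norm (F (u, v)) \<partial>lborel)"
      using int by (intro lborel_pair.integrable_fst' integrable_norm)
    thus "integrable lborel (\<lambda>u. \<integral>s. norm (case (u, s) of (u, s) \<Rightarrow> F (u, s - u)) \<partial>lborel)"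
      by (simp add: lborel_integral_shift[of "\<lambda>v. norm (F (u, v))" u for u])
    show "AE u in lborel. integrable lborel (\<lambda>s. case (u, s) of (u, s) \<Rightarrow> F (u, s - u))"
      using lborel_pair.AE_integrable_fst'[OF int] by (simp add: lborel_integrable_shift[of "\<lambda>v. F (u, v)" u for u])
  qed measurable
  have "integral\<^sup>L (lborel \<Otimes>\<^sub>M lborel) F = (\<integral>u. \<integral>v. F (u, v) \<partial>lborel \<partial>lborel)"
    using lborel_pair.integral_fst'[OF int] by simp
  also have "\<dots> = (\<integral>u. \<integral>s. F (u, s - u) \<partial>lborel \<partial>lborel)"
    by (simp add: lborel_integral_shift[of "\<lambda>v. F (u, v)" u for u])
  also have "\<dots> = (\<integral>s. \<integral>u. F (u, s - u) \<partial>lborel \<partial>lborel)"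
    by (rule lborel_pair.Fubini_integral[symmetric]) (rule int')
  also have "\<dots> = (\<integral>s. beta_integral \<alpha> \<beta> * (if 0 < s then of_real s powr (\<alpha> + \<beta> - 1) * \<psi> s else 0) \<partial>lborel)"
  proof (intro Bochner_Integration.integral_cong refl)
    fix s :: real
    show "(\<integral>u. F (u, s - u) \<partial>lborel) = beta_integral \<alpha> \<beta> * (if 0 < s then of_real s powr (\<alpha> + \<beta> - 1) * \<psi> s else 0)"
    proof (cases "s > 0")
      case False
      hence "(\<lambda>u. F (u, s - u)) = (\<lambda>_. 0)" by (auto simp: F_def fun_eq_iff)
      with False show ?thesis by simp
    next
      case True
      have "(\<integral>u. F (u, s - u) \<partial>lborel) = s *\<^sub>R (\<integral>t. F (0 + s * t, s - (0 + s * t)) \<partial>lborel)"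
        using lborel_integral_real_affine[of s "\<lambda>u. F (u, s - u)" 0] True by simp
      also have "\<dots> = (\<integral>t. of_real s * F (0 + s * t, s - (0 + s * t)) \<partial>lborel)"
        by (simp add: scaleR_conv_of_real)
      also have "\<dots> = (\<integral>t. (if 0 < t \<and> t < 1 then of_real t powr (\<alpha> - 1) * of_real (1 - t) powr (\<beta> - 1) else 0) *
                          (of_real s powr (\<alpha> + \<beta> - 1) * \<psi> s) \<partial>lborel)"
      proof (intro Bochner_Integration.integral_cong refl)
        fix t :: real
        show "of_real s * F (0 + s * t, s - (0 + s * t)) =
              (if 0 < t \<and> t < 1 then of_real t powr (\<alpha> - 1) * of_real (1 - t) powr (\<beta> - 1) else 0) *
                          (of_real s powr (\<alpha> + \<beta> - 1) * \<psi> s)"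
        proof (cases "0 < t \<and> t < 1")
          case t: True
          have "complex_of_real (s * t) powr (\<alpha> - 1) = of_real s powr (\<alpha> - 1) * of_real t powr (\<alpha> - 1)"
               "complex_of_real (s * (1 - t)) powr (\<beta> - 1) = of_real s powr (\<beta> - 1) * of_real (1 - t) powr (\<beta> - 1)"
            using True t unfolding of_real_mult by (intro powr_times_real; simp)+
          moreover have "of_real s * (of_real s powr (\<alpha> - 1) * of_real s powr (\<beta> - 1)) = (of_real s powr (\<alpha> + \<beta> - 1) :: complex)"
            using True by (simp add: powr_diff powr_add)
          moreover have "s - s * t = s * (1 - t)" by (simp add: algebra_simps)
          ultimately show ?thesis using True t
            by (simp add: F_def zero_less_mult_iff) (simp add: algebra_simps)
        next
          case False
          have "\<not> (0 < s * t \<and> 0 < s - s * t)"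
          proof
            assume "0 < s * t \<and> 0 < s - s * t"
            hence "0 < s * t" "0 < s * (1 - t)" by (auto simp: algebra_simps)
            thus False using True False by (simp add: zero_less_mult_iff)
          qed
          thus ?thesis using False by (auto simp: F_def)
        qed
      qed
      also have "\<dots> = beta_integral \<alpha> \<beta> * (of_real s powr (\<alpha> + \<beta> - 1) * \<psi> s)"
        by (simp only: integral_mult_left_zero beta_integral_def)
      finally show ?thesis using True by simp
    qed
  qed
  also have "\<dots> = beta_integral \<alpha> \<beta> * (\<integral>s. (if 0 < s then of_real s powr (\<alpha> + \<beta> - 1) * \<psi> s else 0) \<partial>lborel)"
    by simp
  finally show ?thesis .
qed

text \<open>The case \<open>\<psi> = exp (- s)\<close> of the previous lemma determines the constant.\<close>
lemma beta_integral_eq: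
  assumes "Re \<alpha> > 0" "Re \<beta> > 0"
  shows "beta_integral \<alpha> \<beta> = Gamma \<alpha> * Gamma \<beta> / Gamma (\<alpha> + \<beta>)"
proof -
  define \<psi> where "\<psi> = (\<lambda>s. exp (- complex_of_real s))"
  have [measurable]: "\<psi> \<in> borel_measurable borel" by (simp add: \<psi>_def)
  define f where "f = (\<lambda>\<alpha>. macdonald_integrand (- \<alpha>) 1 0)"
  have f: "integrable lborel (f \<alpha>)" "integral\<^sup>L lborel (f \<alpha>) = Gamma \<alpha>" if "Re \<alpha> > 0" for \<alpha>
    using that integrable_macdonald_integrand_Re_less_0[of "- \<alpha>" 1 0] macdonald_integral_0_right[of "- \<alpha>" 1]
    by (simp_all add: f_def macdonald_integral_def)
  have eq: "(\<lambda>(u, v). f \<alpha> u * f \<beta> v) =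
      (\<lambda>(u, v). if 0 < u \<and> 0 < v then of_real u powr (\<alpha> - 1) * of_real v powr (\<beta> - 1) * \<psi> (u + v) else 0)"
    by (auto simp: f_def macdonald_integrand_def \<psi>_def fun_eq_iff exp_add exp_minus field_simps)
  have "Gamma \<alpha> * Gamma \<beta> = (\<integral>(u, v). f \<alpha> u * f \<beta> v \<partial>(lborel \<Otimes>\<^sub>M lborel))"
    using assms f by (simp add: lborel_pair.integral_times)
  also have "\<dots> = beta_integral \<alpha> \<beta> * (\<integral>s. (if 0 < s then of_real s powr (\<alpha> + \<beta> - 1) * \<psi> s else 0) \<partial>lborel)"
    unfolding eq using lborel_pair.integrable_times[OF f(1)[OF assms(1)] f(1)[OF assms(2)]] unfolding eq
    by (intro integral_convolution_powers) auto
  also have "(\<lambda>s. if 0 < s then of_real s powr (\<alpha> + \<beta> - 1) * \<psi> s else 0) = f (\<alpha> + \<beta>)"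
    by (auto simp: f_def macdonald_integrand_def \<psi>_def fun_eq_iff add.commute)
  also have "integral\<^sup>L lborel (f (\<alpha> + \<beta>)) = Gamma (\<alpha> + \<beta>)"
    using assms by (intro f) auto
  finally have "Gamma \<alpha> * Gamma \<beta> = beta_integral \<alpha> \<beta> * Gamma (\<alpha> + \<beta>)" .
  moreover have "Gamma (\<alpha> + \<beta>) \<noteq> 0"
    using assms by (subst Gamma_eq_zero_iff) (auto elim!: nonpos_Ints_cases simp: complex_eq_iff)
  ultimately show ?thesis by simp
qed

subsection \<open>The convolution formula\<close>

lemma macdonald_integrand_measurable' [measurable (raw)]:
  assumes [measurable]: "q \<in> borel_measurable M" "u \<in> borel_measurable M"
  shows "(\<lambda>w. macdonald_integrand \<nu> p (q w) (u w)) \<in> borel_measurable M"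
  unfolding macdonald_integrand_def powr_def by measurable

text \<open>Moduli stay within the family of integrands, so formulas proved for complex parameters
  also compute integrals of norms.\<close>

lemma macdonald_integrand_of_real_Re:
  "macdonald_integrand (of_real (Re \<nu>)) (of_real (Re p)) (of_real (Re q)) u =
     of_real (norm (macdonald_integrand \<nu> p q u))"
proof (cases "u > 0")
  case True
  have "complex_of_real u powr (- of_real (Re \<nu>) - 1) = of_real (u powr (- Re \<nu> - 1))"
    using powr_of_real[of u "- Re \<nu> - 1"] True by simp
  thus ?thesis using True
    unfolding norm_macdonald_integrand unfolding macdonald_integrand_def by (simp flip: exp_of_real)
qed (simp add: macdonald_integrand_def)

text \<open>The Gaussian constant contributes (u v)^(n/2), which cancels the n/2 in both orders, and
  (u + v)^(-n/2), which together with the exponentials is an integrand of order n/2 - 1 at u +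
  v.\<close>

lemma has_bochner_integral_macdonald_integrands:
  fixes x y :: "'a :: euclidean_space" and \<alpha> \<beta> c :: complex
  assumes c: "Re c > 0"
  defines "n2 \<equiv> of_nat DIM('a) / 2"
  shows "has_bochner_integral lborel
           (\<lambda>w. macdonald_integrand (n2 - \<alpha>) c (c * of_real ((norm (x - w))\<^sup>2)) u *
                macdonald_integrand (n2 - \<beta>) c (c * of_real ((norm (w - y))\<^sup>2)) v)
           (of_real (sqrt pi) ^ DIM('a) * c powr (- n2) *
             (if 0 < u \<and> 0 < v
              then of_real u powr (\<alpha> - 1) * of_real v powr (\<beta> - 1) *
                   macdonald_integrand (n2 - 1) c (c * of_real ((norm (x - y))\<^sup>2)) (u + v)
              else 0))"
proof (cases "0 < u \<and> 0 < v")
  case True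
  hence uv: "u > 0" "v > 0" "u + v > 0" by auto
  define A where "A = of_real u powr (\<alpha> - n2 - 1) * exp (- (c * of_real u)) *
                        (of_real v powr (\<beta> - n2 - 1) * exp (- (c * of_real v)))"
  have int: "has_bochner_integral lborel
     (\<lambda>w. A * (exp (- (c * of_real ((norm (x - w))\<^sup>2 / u))) * exp (- (c * of_real ((norm (w - y))\<^sup>2 / v)))))
     (A * (of_real (sqrt pi) ^ DIM('a) * (c * of_real ((u + v) / (u * v))) powr (- of_nat DIM('a) / 2) *
              exp (- (c * of_real ((norm (x - y))\<^sup>2 / (u + v))))))"
    by (intro has_bochner_integral_mult_right has_bochner_integral_gaussian_convolution c uv)
  \<comment> \<open>The complex power may be split because one of the two factors is a positive
    real.\<close>
  have "(c * of_real ((u + v) / (u * v))) powr (- n2) = of_real ((u + v) / (u * v)) powr (- n2) * c powr (- n2)"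
    using uv by (subst mult.commute, intro powr_times_real_left) auto
  also have "complex_of_real ((u + v) / (u * v)) powr (- n2) = of_real (u + v) powr (- n2) * of_real u powr n2 * of_real v powr n2"
  proof -
    have "(u + v) / (u * v) > 0" using uv by simp
    moreover have "ln ((u + v) / (u * v)) = ln (u + v) - ln u - ln v"
      using uv by (simp add: ln_div ln_mult)
    ultimately have "complex_of_real ((u + v) / (u * v)) powr (- n2) =
        exp (- n2 * (of_real (ln (u + v)) - of_real (ln u) - of_real (ln v)))"
      using uv by (simp add: powr_def Ln_of_real del: of_real_divide of_real_add of_real_mult)
    also have "\<dots> = exp (- n2 * of_real (ln (u + v))) * exp (n2 * of_real (ln u)) * exp (n2 * of_real (ln v))"
      by (simp add: algebra_simps flip: exp_add)
    also have "\<dots> = of_real (u + v) powr (- n2) * of_real u powr n2 * of_real v powr n2"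
      using uv by (simp add: powr_def Ln_of_real del: of_real_add)
    finally show ?thesis .
  qed
  finally have P: "(c * of_real ((u + v) / (u * v))) powr (- n2) =
     of_real (u + v) powr (- n2) * of_real u powr n2 * of_real v powr n2 * c powr (- n2)" .
  have pw: "of_real r powr (\<gamma> - n2 - 1) * of_real r powr n2 = (of_real r powr (\<gamma> - 1) :: complex)" if "r > 0" for r \<gamma>
    using that by (simp add: powr_diff)
  have A: "A * (of_real u powr n2 * of_real v powr n2) = of_real u powr (\<alpha> - 1) * of_real v powr (\<beta> - 1) * exp (- (c * of_real (u + v)))"
    unfolding A_def pw[OF uv(1), of \<alpha>, symmetric] pw[OF uv(2), of \<beta>, symmetric]
    by (simp add: algebra_simps exp_add exp_diff) (simp add: exp_minus divide_inverse)
  have n2: "- of_nat DIM('a) / 2 = - n2" by (simp add: n2_def)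
  have "A * (of_real (sqrt pi) ^ DIM('a) * (c * of_real ((u + v) / (u * v))) powr (- of_nat DIM('a) / 2) *
              exp (- (c * of_real ((norm (x - y))\<^sup>2 / (u + v))))) =
        of_real (sqrt pi) ^ DIM('a) * c powr (- n2) * (A * (of_real u powr n2 * of_real v powr n2)) *
          of_real (u + v) powr (- n2) * exp (- (c * of_real ((norm (x - y))\<^sup>2 / (u + v))))"
    unfolding n2 P by (simp only: mult_ac)
  also have "\<dots> = of_real (sqrt pi) ^ DIM('a) * c powr (- n2) *
             (of_real u powr (\<alpha> - 1) * of_real v powr (\<beta> - 1) *
                   macdonald_integrand (n2 - 1) c (c * of_real ((norm (x - y))\<^sup>2)) (u + v))"
    unfolding A using uv by (simp add: macdonald_integrand_def)
  finally have val: "A * (of_real (sqrt pi) ^ DIM('a) * (c * of_real ((u + v) / (u * v))) powr (- of_nat DIM('a) / 2) *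
              exp (- (c * of_real ((norm (x - y))\<^sup>2 / (u + v))))) =
     of_real (sqrt pi) ^ DIM('a) * c powr (- n2) *
             (of_real u powr (\<alpha> - 1) * of_real v powr (\<beta> - 1) *
                   macdonald_integrand (n2 - 1) c (c * of_real ((norm (x - y))\<^sup>2)) (u + v))" .
  have fn: "(\<lambda>w. A * (exp (- (c * of_real ((norm (x - w))\<^sup>2 / u))) * exp (- (c * of_real ((norm (w - y))\<^sup>2 / v))))) =
     (\<lambda>w. macdonald_integrand (n2 - \<alpha>) c (c * of_real ((norm (x - w))\<^sup>2)) u *
                macdonald_integrand (n2 - \<beta>) c (c * of_real ((norm (w - y))\<^sup>2)) v)"
    using uv by (simp add: A_def macdonald_integrand_def fun_eq_iff)
  show ?thesis using int unfolding val fn using True by simp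
next
  case False
  hence "(\<lambda>w. macdonald_integrand (n2 - \<alpha>) c (c * of_real ((norm (x - w))\<^sup>2)) u *
                macdonald_integrand (n2 - \<beta>) c (c * of_real ((norm (w - y))\<^sup>2)) v) = (\<lambda>_. 0)"
    by (auto simp: macdonald_integrand_def fun_eq_iff)
  thus ?thesis unfolding if_not_P[OF False] by (simp add: has_bochner_integral_zero)
qed

text \<open>With s = Re \<nu> + 1, the factor (u + v)^(-s) exp (- Re q / (u + v)) is bounded by (s /
  Re q)^s. What is left is a product of two Gamma integrands.\<close>

lemma integrable_powers_times_macdonald_integrand:
  fixes \<alpha> \<beta> c :: complex
  assumes "Re \<alpha> > 0" "Re \<beta> > 0" "Re c > 0" "Re q > 0" "Re \<nu> > - 1"
  shows "integrable (lborel \<Otimes>\<^sub>M lborel) (\<lambda>(u :: real, v :: real).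
           if 0 < u \<and> 0 < v then of_real u powr (\<alpha> - 1) * of_real v powr (\<beta> - 1) * macdonald_integrand \<nu> c q (u + v) else 0)"
proof -
  define f where "f = (\<lambda>\<alpha>. macdonald_integrand (- \<alpha>) c 0)"
  define s where "s = Re \<nu> + 1"
  have s: "s > 0" using assms by (simp add: s_def)
  have "integrable lborel (f \<gamma>)" if "Re \<gamma> > 0" for \<gamma>
    unfolding f_def using that assms by (intro integrable_macdonald_integrand_Re_less_0) auto
  hence int: "integrable (lborel \<Otimes>\<^sub>M lborel) (\<lambda>p. of_real ((s / Re q) powr s) * (case p of (u, v) \<Rightarrow> f \<alpha> u * f \<beta> v))"
    using assms by (intro integrable_mult_right lborel_pair.integrable_times) auto
  show ?thesis
  proof (rule Bochner_Integration.integrable_bound[OF int])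
    show "(\<lambda>(u :: real, v :: real). if 0 < u \<and> 0 < v then of_real u powr (\<alpha> - 1) * of_real v powr (\<beta> - 1) *
             macdonald_integrand \<nu> c q (u + v) else 0) \<in> borel_measurable (lborel \<Otimes>\<^sub>M lborel)"
      unfolding powr_def by measurable
    have "norm (of_real u powr (\<alpha> - 1) * of_real v powr (\<beta> - 1) * macdonald_integrand \<nu> c q (u + v)) \<le>
          norm (of_real ((s / Re q) powr s) * (f \<alpha> u * f \<beta> v))" if uv: "u > 0" "v > 0" for u v
    proof -
      have pos: "u + v > 0" using uv by simp
      have "exp (- (Re q / (u + v))) \<le> (s / (Re q / (u + v))) powr s"
        using s pos assms by (intro exp_minus_le_powr) auto
      also have "\<dots> = (s / Re q) powr s * (u + v) powr s"
        using s pos assms by (simp flip: powr_mult)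
      finally have "(u + v) powr (- s) * exp (- (Re q / (u + v))) \<le> (u + v) powr (- s) * ((s / Re q) powr s * (u + v) powr s)"
        by (rule mult_left_mono) auto
      also have "\<dots> = (s / Re q) powr s"
        using pos by (simp add: powr_minus)
      finally have "u powr (Re \<alpha> - 1) * v powr (Re \<beta> - 1) * exp (- (Re c * (u + v))) *
             ((u + v) powr (- s) * exp (- (Re q / (u + v)))) \<le>
          u powr (Re \<alpha> - 1) * v powr (Re \<beta> - 1) * exp (- (Re c * (u + v))) * (s / Re q) powr s"
        by (rule mult_left_mono) auto
      also have expE: "exp (- (Re c * (u + v))) = exp (- (Re c * u)) * exp (- (Re c * v))"
        by (simp add: distrib_left flip: exp_add)
      finally have "u powr (Re \<alpha> - 1) * v powr (Re \<beta> - 1) * (exp (- (Re c * u)) * exp (- (Re c * v))) *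
             ((u + v) powr (- s) * exp (- (Re q / (u + v)))) \<le>
          u powr (Re \<alpha> - 1) * v powr (Re \<beta> - 1) * (exp (- (Re c * u)) * exp (- (Re c * v))) * (s / Re q) powr s" .
      moreover have "norm (of_real u powr (\<alpha> - 1) * of_real v powr (\<beta> - 1) * macdonald_integrand \<nu> c q (u + v)) =
          u powr (Re \<alpha> - 1) * v powr (Re \<beta> - 1) * (exp (- (Re c * u)) * exp (- (Re c * v))) *
             ((u + v) powr (- s) * exp (- (Re q / (u + v))))"
        using uv pos by (simp add: norm_mult norm_macdonald_integrand norm_powr_real_powr s_def expE mult_ac)
      moreover have "norm (of_real ((s / Re q) powr s) * (f \<alpha> u * f \<beta> v)) =
          u powr (Re \<alpha> - 1) * v powr (Re \<beta> - 1) * (exp (- (Re c * u)) * exp (- (Re c * v))) * (s / Re q) powr s"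
        using uv by (simp add: norm_mult norm_macdonald_integrand f_def)
      ultimately show ?thesis by simp
    qed
    thus "AE p in lborel \<Otimes>\<^sub>M lborel. norm (case p of (u, v) \<Rightarrow> if 0 < u \<and> 0 < v then of_real u powr (\<alpha> - 1) * of_real v powr (\<beta> - 1) *
             macdonald_integrand \<nu> c q (u + v) else 0) \<le> norm (of_real ((s / Re q) powr s) * (case p of (u, v) \<Rightarrow> f \<alpha> u * f \<beta> v))"
      by (intro AE_I2) (auto simp del: norm_mult)
  qed
qed

lemma has_bochner_integral_macdonald_convolution:
  fixes x y :: "'a :: euclidean_space" and \<alpha> \<beta> c :: complex
  assumes \<alpha>\<beta>: "Re \<alpha> > 0" "Re \<beta> > 0" and c: "Re c > 0" and xy: "x \<noteq> y"
  defines "n2 \<equiv> of_nat DIM('a) / 2"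
  shows "has_bochner_integral lborel
           (\<lambda>w. macdonald_integral (n2 - \<alpha>) c (c * of_real ((norm (x - w))\<^sup>2)) *
                macdonald_integral (n2 - \<beta>) c (c * of_real ((norm (w - y))\<^sup>2)))
           (of_real (sqrt pi) ^ DIM('a) * c powr (- n2) * (Gamma \<alpha> * Gamma \<beta> / Gamma (\<alpha> + \<beta>)) *
             macdonald_integral (n2 - \<alpha> - \<beta>) c (c * of_real ((norm (x - y))\<^sup>2)))"
proof -
  \<comment> \<open>The parameters stay arguments of \<open>h\<close>, \<open>J\<close> and
    \<open>C\<close>, so that these can also be taken at the real parts of \<alpha>, \<beta> and
    c.\<close>
  define h where "h = (\<lambda>\<alpha> \<beta> c. \<lambda>(u, v) w.
      macdonald_integrand (n2 - \<alpha>) c (c * of_real ((norm (x - w))\<^sup>2)) u *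
      macdonald_integrand (n2 - \<beta>) c (c * of_real ((norm (w - y))\<^sup>2)) v)"
  define J where "J = (\<lambda>\<alpha> \<beta> c. \<lambda>(u :: real, v :: real).
      if 0 < u \<and> 0 < v then of_real u powr (\<alpha> - 1) * of_real v powr (\<beta> - 1) *
        macdonald_integrand (n2 - 1) c (c * of_real ((norm (x - y))\<^sup>2)) (u + v) else 0)"
  define C where "C = (\<lambda>c. of_real (sqrt pi) ^ DIM('a) * c powr (- n2))"
  have hJ: "has_bochner_integral lborel (h \<alpha> \<beta> c p) (C c * J \<alpha> \<beta> c p)" if "Re c > 0" for \<alpha> \<beta> c p
    using has_bochner_integral_macdonald_integrands[OF that, where 'a = 'a, of \<alpha> x "fst p" \<beta> y "snd p"]
    by (simp only: h_def J_def C_def n2_def case_prod_beta)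
  \<comment> \<open>The order n/2 - 1 exceeds -1 because the dimension is positive, and x \<noteq> y
    provides the decay at u + v = 0.\<close>
  have intJ: "integrable (lborel \<Otimes>\<^sub>M lborel) (J \<alpha> \<beta> c)" if "Re \<alpha> > 0" "Re \<beta> > 0" "Re c > 0" for \<alpha> \<beta> c
    unfolding J_def using that xy
    by (intro integrable_powers_times_macdonald_integrand) (auto simp: n2_def)
  have norm_h: "of_real (norm (h \<alpha> \<beta> c p w)) = h (of_real (Re \<alpha>)) (of_real (Re \<beta>)) (of_real (Re c)) p w" for p w
    using macdonald_integrand_of_real_Re[of "n2 - \<alpha>" c "c * of_real ((norm (x - w))\<^sup>2)" "fst p"]
      macdonald_integrand_of_real_Re[of "n2 - \<beta>" c "c * of_real ((norm (w - y))\<^sup>2)" "snd p"]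
    by (simp add: h_def case_prod_beta norm_mult n2_def)
  \<comment> \<open>The norm of \<open>h\<close> is \<open>h\<close> at real parameters, so its
    integral over w is again given by \<open>hJ\<close>; this is the absolute convergence needed for
    Fubini.\<close>
  have norm_int: "of_real (\<integral>w. norm (h \<alpha> \<beta> c p w) \<partial>lborel) =
      C (of_real (Re c)) * J (of_real (Re \<alpha>)) (of_real (Re \<beta>)) (of_real (Re c)) p" for p
  proof -
    have "of_real (\<integral>w. norm (h \<alpha> \<beta> c p w) \<partial>lborel) = (\<integral>w. complex_of_real (norm (h \<alpha> \<beta> c p w)) \<partial>lborel)"
      using hJ[OF c, of \<alpha> \<beta> p] by (intro integral_of_real[symmetric]) (simp add: has_bochner_integral_iff)
    also have "\<dots> = C (of_real (Re c)) * J (of_real (Re \<alpha>)) (of_real (Re \<beta>)) (of_real (Re c)) p"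
      unfolding norm_h using hJ[of "of_real (Re c)"] c by (simp add: has_bochner_integral_iff)
    finally show ?thesis .
  qed
  have "(\<lambda>(p, w). h \<alpha> \<beta> c p w) \<in> borel_measurable ((lborel \<Otimes>\<^sub>M lborel) \<Otimes>\<^sub>M lborel)"
    unfolding h_def case_prod_beta by measurable
  hence meas: "(\<lambda>(p, w). h \<alpha> \<beta> c p w) \<in> borel_measurable (lborel \<Otimes>\<^sub>M lborel)"
    unfolding lborel_prod .
  have int: "integrable (lborel \<Otimes>\<^sub>M lborel) (\<lambda>(p, w). h \<alpha> \<beta> c p w)"
  proof (rule lborel_pair.Fubini_integrable)
    have "integrable (lborel \<Otimes>\<^sub>M lborel) (\<lambda>p. Re (C (of_real (Re c)) * J (of_real (Re \<alpha>)) (of_real (Re \<beta>)) (of_real (Re c)) p))"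
      using \<alpha>\<beta> c by (intro integrable_Re integrable_mult_right intJ) auto
    also have "(\<lambda>p. Re (C (of_real (Re c)) * J (of_real (Re \<alpha>)) (of_real (Re \<beta>)) (of_real (Re c)) p)) =
        (\<lambda>p. \<integral>w. norm (h \<alpha> \<beta> c p w) \<partial>lborel)"
      by (simp flip: norm_int)
    finally show "integrable lborel (\<lambda>p. \<integral>w. norm (case (p, w) of (p, w) \<Rightarrow> h \<alpha> \<beta> c p w) \<partial>lborel)"
      by (simp add: lborel_prod)
    show "AE p in lborel. integrable lborel (\<lambda>w. case (p, w) of (p, w) \<Rightarrow> h \<alpha> \<beta> c p w)"
      using hJ[OF c] by (simp add: has_bochner_integral_iff)
  qed (rule meas)
  have "has_bochner_integral lborel (\<lambda>w. \<integral>p. h \<alpha> \<beta> c p w \<partial>lborel) (\<integral>p. \<integral>w. h \<alpha> \<beta> c p w \<partial>lborel \<partial>lborel)"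
    using lborel_pair.integrable_snd[OF int] lborel_pair.Fubini_integral[OF int]
    by (simp add: has_bochner_integral_iff)
  also have "(\<integral>p. \<integral>w. h \<alpha> \<beta> c p w \<partial>lborel \<partial>lborel) = (\<integral>p. C c * J \<alpha> \<beta> c p \<partial>(lborel \<Otimes>\<^sub>M lborel))"
    using hJ[OF c] by (simp add: has_bochner_integral_iff lborel_prod)
  also have "\<dots> = C c * integral\<^sup>L (lborel \<Otimes>\<^sub>M lborel) (J \<alpha> \<beta> c)"
    by simp
  also have "integral\<^sup>L (lborel \<Otimes>\<^sub>M lborel) (J \<alpha> \<beta> c) = beta_integral \<alpha> \<beta> *
      (\<integral>s. (if 0 < s then of_real s powr (\<alpha> + \<beta> - 1) * macdonald_integrand (n2 - 1) c (c * of_real ((norm (x - y))\<^sup>2)) s else 0) \<partial>lborel)"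
    using intJ[OF \<alpha>\<beta> c] unfolding J_def by (intro integral_convolution_powers) auto
  also have "(\<lambda>s. if 0 < s then of_real s powr (\<alpha> + \<beta> - 1) * macdonald_integrand (n2 - 1) c (c * of_real ((norm (x - y))\<^sup>2)) s else 0) =
      macdonald_integrand (n2 - \<alpha> - \<beta>) c (c * of_real ((norm (x - y))\<^sup>2))"
  proof
    fix s :: real
    have "of_real s powr (\<alpha> + \<beta> - 1) * of_real s powr (- n2) = (of_real s powr (- (n2 - \<alpha> - \<beta>) - 1) :: complex)" if "s > 0"
      using that by (simp add: algebra_simps flip: powr_add)
    thus "(if 0 < s then of_real s powr (\<alpha> + \<beta> - 1) * macdonald_integrand (n2 - 1) c (c * of_real ((norm (x - y))\<^sup>2)) s else 0) =
      macdonald_integrand (n2 - \<alpha> - \<beta>) c (c * of_real ((norm (x - y))\<^sup>2)) s"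
      by (simp add: macdonald_integrand_def mult.assoc [symmetric])
  qed
  also have "has_bochner_integral lborel (\<lambda>w. \<integral>p. h \<alpha> \<beta> c p w \<partial>lborel)
      (C c * (beta_integral \<alpha> \<beta> * integral\<^sup>L lborel (macdonald_integrand (n2 - \<alpha> - \<beta>) c (c * of_real ((norm (x - y))\<^sup>2))))) \<longleftrightarrow>
    has_bochner_integral lborel (\<lambda>w. macdonald_integral (n2 - \<alpha>) c (c * of_real ((norm (x - w))\<^sup>2)) *
                macdonald_integral (n2 - \<beta>) c (c * of_real ((norm (w - y))\<^sup>2)))
      (C c * (beta_integral \<alpha> \<beta> * integral\<^sup>L lborel (macdonald_integrand (n2 - \<alpha> - \<beta>) c (c * of_real ((norm (x - y))\<^sup>2)))))"
  \<comment> \<open>At w = x or w = y one of the parameters q is 0, and the integral over u or v may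
    diverge; these two points form a null set.\<close>
  proof (rule has_bochner_integral_discrete_difference[of "{x, y}"])
    fix w assume "w \<notin> {x, y}"
    hence w: "w \<noteq> x" "w \<noteq> y" by auto
    have "(\<integral>p. h \<alpha> \<beta> c p w \<partial>lborel) = (\<integral>(u, v).
        macdonald_integrand (n2 - \<alpha>) c (c * of_real ((norm (x - w))\<^sup>2)) u *
        macdonald_integrand (n2 - \<beta>) c (c * of_real ((norm (w - y))\<^sup>2)) v \<partial>(lborel \<Otimes>\<^sub>M lborel))"
      unfolding lborel_prod h_def case_prod_beta ..
    also have "\<dots> = macdonald_integral (n2 - \<alpha>) c (c * of_real ((norm (x - w))\<^sup>2)) *
                macdonald_integral (n2 - \<beta>) c (c * of_real ((norm (w - y))\<^sup>2))"
      unfolding macdonald_integral_def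
      using c w by (intro lborel_pair.integral_times integrable_macdonald_integrand) auto
    finally show "(\<integral>p. h \<alpha> \<beta> c p w \<partial>lborel) = macdonald_integral (n2 - \<alpha>) c (c * of_real ((norm (x - w))\<^sup>2)) *
                macdonald_integral (n2 - \<beta>) c (c * of_real ((norm (w - y))\<^sup>2))" .
  qed auto
  finally show ?thesis
    by (simp add: C_def beta_integral_eq[OF \<alpha>\<beta>] macdonald_integral_def mult_ac)
qed

text \<open>What remains is to place (-z)^(1/2) in the right half plane and to match powers on the
  principal branch. A statement about \<open>has_bochner_integral\<close> includes absolute
  convergence.\<close>

theorem theorem4p1:
  fixes \<alpha> \<beta> z :: complex and x y :: "real ^ 'n"
  assumes "Re \<alpha> > 0" and "Re \<beta> > 0"
    and "z \<notin> complex_of_real ` {0..}"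
    and "x \<noteq> y"
  shows "has_bochner_integral lborel
    (\<lambda>x' :: real ^ 'n.
       bessel_K (of_nat CARD('n) / 2 - \<alpha>) ((- z) powr (1 / 2) * of_real (norm (x - x'))) *
       bessel_K (of_nat CARD('n) / 2 - \<beta>) ((- z) powr (1 / 2) * of_real (norm (x' - y))) /
       (of_real (norm (x - x')) powr (of_nat CARD('n) / 2 - \<alpha>) *
        of_real (norm (x' - y)) powr (of_nat CARD('n) / 2 - \<beta>)))
    (kappa \<alpha> \<beta> CARD('n) / (- z) powr (of_nat CARD('n) / 4) *
       (bessel_K (of_nat CARD('n) / 2 - \<alpha> - \<beta>) ((- z) powr (1 / 2) * of_real (norm (x - y))) /
        of_real (norm (x - y)) powr (of_nat CARD('n) / 2 - \<alpha> - \<beta>)))"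
proof -
  define k where "k = (- z) powr (1 / 2)"
  define c where "c = k / 2"
  define n2 :: complex where "n2 = of_nat CARD('n) / 2"
  have z: "- z \<notin> \<real>\<^sub>\<le>\<^sub>0"
  proof
    assume "- z \<in> \<real>\<^sub>\<le>\<^sub>0"
    hence "z = complex_of_real (Re z)" "Re z \<ge> 0"
      by (auto simp: complex_nonpos_Reals_iff complex_eq_iff)
    thus False using assms(3) by (metis atLeast_iff imageI)
  qed
  hence z0: "z \<noteq> 0" by auto
  \<comment> \<open>Off the cut |arg (-z)| < pi, and the square root halves the argument, so its
    cosine is positive.\<close>
  have k: "Re k > 0"
  proof -
    have "\<bar>Im (Ln (- z))\<bar> < pi"
      using Im_Ln_less_pi[OF z] mpi_less_Im_Ln[of "- z"] z0 by (simp add: abs_less_iff)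
    hence "cos (Im (Ln (- z)) / 2) > 0"
      by (intro cos_gt_zero_pi) auto
    thus ?thesis using z0 by (simp add: k_def powr_def Re_exp)
  qed
  hence k0: "k \<noteq> 0" and c: "Re c > 0" by (auto simp: c_def)
  \<comment> \<open>The halved argument stays in the principal range, hence k^(n/2) = (-z)^(n/4)
    without a branch correction.\<close>
  have Ln_k: "Ln k = Ln (- z) / 2"
  proof -
    have "k = exp (Ln (- z) / 2)" using z0 by (simp add: k_def powr_def)
    moreover have "- pi < Im (Ln (- z) / 2)" "Im (Ln (- z) / 2) \<le> pi"
      using mpi_less_Im_Ln[of "- z"] Im_Ln_le_pi[of "- z"] z0 by auto
    ultimately show ?thesis by (simp add: Ln_exp)
  qed
  have K: "bessel_K \<nu> (k * of_real r) / of_real r powr \<nu> = macdonald_integral \<nu> c (c * of_real (r\<^sup>2)) / 2" if "r > 0" for \<nu> r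
    using bessel_K_eq_macdonald_integral[OF k that] by (simp add: c_def)
  define M where "M = macdonald_integral (n2 - \<alpha> - \<beta>) c (c * of_real ((norm (x - y))\<^sup>2))"
  have "has_bochner_integral lborel
     (\<lambda>w. macdonald_integral (n2 - \<alpha>) c (c * of_real ((norm (x - w))\<^sup>2)) *
          macdonald_integral (n2 - \<beta>) c (c * of_real ((norm (w - y))\<^sup>2)) / 4)
     (of_real (sqrt pi) ^ CARD('n) * c powr (- n2) * (Gamma \<alpha> * Gamma \<beta> / Gamma (\<alpha> + \<beta>)) * M / 4)"
    using has_bochner_integral_divide_zero[OF has_bochner_integral_macdonald_convolution[OF assms(1,2) c assms(4)], of 4]
    by (simp add: n2_def M_def)
  also have "?this \<longleftrightarrow> has_bochner_integral lborel
     (\<lambda>w. bessel_K (n2 - \<alpha>) (k * of_real (norm (x - w))) * bessel_K (n2 - \<beta>) (k * of_real (norm (w - y))) /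
       (of_real (norm (x - w)) powr (n2 - \<alpha>) * of_real (norm (w - y)) powr (n2 - \<beta>)))
     (of_real (sqrt pi) ^ CARD('n) * c powr (- n2) * (Gamma \<alpha> * Gamma \<beta> / Gamma (\<alpha> + \<beta>)) * M / 4)"
  \<comment> \<open>At w = x and w = y the quotient of K by a power of 0 has only a default value;
    both points are discarded.\<close>
  proof (rule has_bochner_integral_discrete_difference[of "{x, y}"])
    fix w assume "w \<notin> {x, y}"
    hence w: "norm (x - w) > 0" "norm (w - y) > 0" by auto
    show "macdonald_integral (n2 - \<alpha>) c (c * of_real ((norm (x - w))\<^sup>2)) *
          macdonald_integral (n2 - \<beta>) c (c * of_real ((norm (w - y))\<^sup>2)) / 4 =
       bessel_K (n2 - \<alpha>) (k * of_real (norm (x - w))) * bessel_K (n2 - \<beta>) (k * of_real (norm (w - y))) /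
       (of_real (norm (x - w)) powr (n2 - \<alpha>) * of_real (norm (w - y)) powr (n2 - \<beta>))"
      unfolding times_divide_times_eq[symmetric] K[OF w(1)] K[OF w(2)] by simp
  qed auto
  \<comment> \<open>Source of the constant: c = k / 2 turns c^(-n/2) into 2^(n/2) k^(-n/2), which
    with sqrt pi ^ n gives (2 pi)^(n/2). Of the factor 1/4, one half belongs to the K on the right,
    since it equals M / 2, and the other is the 2^(-1) in \<open>kappa\<close>.\<close>
  also have "of_real (sqrt pi) ^ CARD('n) * c powr (- n2) * (Gamma \<alpha> * Gamma \<beta> / Gamma (\<alpha> + \<beta>)) * M / 4 =
     kappa \<alpha> \<beta> CARD('n) / (- z) powr (of_nat CARD('n) / 4) *
       (bessel_K (n2 - \<alpha> - \<beta>) (k * of_real (norm (x - y))) / of_real (norm (x - y)) powr (n2 - \<alpha> - \<beta>))"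
  proof -
    have "sqrt pi = exp (ln pi / 2)"
      by (simp add: powr_def flip: powr_half_sqrt)
    hence "complex_of_real (sqrt pi) = exp (of_real (ln pi) / 2)"
      by (simp flip: exp_of_real)
    hence "of_real (sqrt pi) ^ CARD('n) = (of_real pi powr n2 :: complex)"
      by (simp add: powr_def n2_def Ln_of_real flip: exp_of_nat_mult)
    moreover have "c powr (- n2) = 2 powr n2 * k powr (- n2)"
    proof -
      have "c powr (- n2) = (of_real (1 / 2) * k) powr (- n2)" by (simp add: c_def)
      also have "\<dots> = of_real (1 / 2) powr (- n2) * k powr (- n2)"
        by (intro powr_times_real_left) auto
      also have "complex_of_real (1 / 2) powr (- n2) = 2 powr n2"
      proof -
        have "Ln (complex_of_real (1 / 2)) = - Ln (complex_of_real 2)"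
          by (subst (1 2) Ln_of_real) (simp_all add: ln_div)
        thus ?thesis by (simp add: powr_def)
      qed
      finally show ?thesis .
    qed
    moreover have "(2 * of_real pi) powr n2 = 2 powr n2 * (of_real pi powr n2 :: complex)"
      by (intro powr_times_real) auto
    moreover have "(- z) powr (of_nat CARD('n) / 4) = k powr n2"
      using z0 k0 by (simp add: powr_def Ln_k n2_def)
    moreover have "bessel_K (n2 - \<alpha> - \<beta>) (k * of_real (norm (x - y))) / of_real (norm (x - y)) powr (n2 - \<alpha> - \<beta>) = M / 2"
      unfolding M_def using assms(4) by (intro K) auto
    moreover have "kappa \<alpha> \<beta> CARD('n) = (2 * of_real pi) powr n2 * inverse 2 * Gamma \<alpha> * Gamma \<beta> / Gamma (\<alpha> + \<beta>)"
      by (simp add: kappa_def n2_def)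
    moreover have "k powr (- n2) = 1 / k powr n2"
      by (simp add: powr_minus divide_inverse)
    ultimately show ?thesis
      by (simp only:) (simp add: mult_ac)
  qed
  finally show ?thesis unfolding n2_def k_def .
qed

end
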